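(* Let $z_0\in\mathbb{C}$ and let $f$ be a non-constant complex-valued function holomorphic on an open neighbourhood of $z_0$ with $f(z_0)=z_0$ and $f'(z_0)=0$. Let $p:=\min\{n\in\mathbb{N}:f^{(n)}(z_0)\neq0\}\geq2$, and let $U$ be an open neighbourhood of $z_0$ with $f(U)\subset U$, $V\subset\mathbb{D}$ an open neighbourhood of $0$, and $\varphi:U\to V$ a conformal map with $\varphi(f^n(z))=(\varphi(z))^{p^n}$ for all $z\in U$ and $n\in\mathbb{N}$. For $\delta>0$ with $U_\delta[0]\subset V$ put $B_\delta:=\varphi^{-1}(U_\delta[0])$. Then for each $\delta>0$ with $U_\delta[0]\subset V$, comeager many $K\in\mathcal{K}(B_\delta)$ have the property that comeager many functions in $H(\mathbb{C}\setminus\{z_0\})$ are $C(K)$-universal for $C_f$.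
   Context: $\mathbb{N}=\{1,2,\dots\}$; $f^n$ is the $n$-th iterate of $f$ and $f^{(n)}$ its $n$-th derivative. $\mathbb{D}$ is the open unit disc, $U_\delta[0]=\{z\in\mathbb{C}:|z|\leq\delta\}$. A conformal map is a bijective holomorphic map. (Such $U$, $V$, $\varphi$ exist by Böttcher's theorem; one has $\varphi(z_0)=0$.) $\mathcal{K}(B_\delta)$ is the set of all non-empty compact subsets of $B_\delta$, endowed with the Hausdorff distance; it is a complete metric space. $H(\mathbb{C}\setminus\{z_0\})$ is the Fréchet space of holomorphic functions on $\mathbb{C}\setminus\{z_0\}$ with the topology of locally uniform convergence. For compact $K$, $C(K)$ is the Banach space of continuous complex-valued functions on $K$ with the uniform norm. A function $g\in H(\mathbb{C}\setminus\{z_0\})$ is called $C(K)$-universal for $C_f$ (the composition operator $g\mapsto g\circ f$) if $\{g\circ f^n|_K:n\in\mathbb{N}\}$ is dense in $C(K)$; this includes the requirement $K\subset U\setminus\{z_0\}$, so that the functions $g\circ f^n|_K$ are defined. A subset of a Baire space is comeager if it contains a dense $G_\delta$-set; "comeager many elements of a space have a property" means that the set of elements having the property is comeager. The comeager set of functions may depend on $K$. *)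

theory Defs
  imports "HOL-Analysis.Analysis"
begin

definition comeager_in :: "'a topology \<Rightarrow> 'a set \<Rightarrow> bool"
  where "comeager_in X A \<longleftrightarrow>
    A \<subseteq> topspace X \<and> (\<exists>G. gdelta_in X G \<and> X closure_of G = topspace X \<and> G \<subseteq> A)"


subsection \<open>Non-empty compact subsets with the Hausdorff distance\<close>

definition nonempty_compacts :: "'a::metric_space set \<Rightarrow> 'a set set"
  where "nonempty_compacts B = {K. compact K \<and> K \<noteq> {} \<and> K \<subseteq> B}"

text \<open>The value 0 for empty or unbounded sets is a convention that is never used on
  \<^term>\<open>nonempty_compacts B\<close>; it makes the distance non-negative on all pairs of sets, as the
  locale \<^locale>\<open>Metric_space\<close> requires.\<close>

definition hausdorff_dist :: "'a::metric_space set \<Rightarrow> 'a set \<Rightarrow> real"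
  where "hausdorff_dist A B =
    (if A \<noteq> {} \<and> B \<noteq> {} \<and> bounded A \<and> bounded B
     then max (SUP x\<in>A. infdist x B) (SUP y\<in>B. infdist y A) else 0)"

definition compacts_topology :: "'a::metric_space set \<Rightarrow> 'a set topology"
  where "compacts_topology B = Metric_space.mtopology (nonempty_compacts B) hausdorff_dist"

lemma bdd_above_infdist:
  fixes A :: "'a::metric_space set"
  assumes "bounded A"
  shows "bdd_above ((\<lambda>x. infdist x B) ` A)"
proof -
  obtain a e where "\<forall>x\<in>A. dist a x \<le> e"
    using assms unfolding bounded_def by blast
  then have "infdist x B \<le> infdist a B + e" if "x \<in> A" for x
    using infdist_triangle[of x B a] that by (fastforce simp: dist_commute)
  then show ?thesis by (intro bdd_aboveI2)
qed

lemma infdist_le_hausdorff_dist: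
  fixes A :: "'a::metric_space set"
  assumes "bounded A" "bounded B" "B \<noteq> {}" "x \<in> A"
  shows "infdist x B \<le> hausdorff_dist A B"
proof -
  have "infdist x B \<le> (SUP x\<in>A. infdist x B)"
    by (rule cSUP_upper[OF assms(4) bdd_above_infdist[OF assms(1)]])
  moreover have "A \<noteq> {}" using assms(4) by blast
  ultimately show ?thesis using assms unfolding hausdorff_dist_def by simp
qed

lemma hausdorff_dist_commute: "hausdorff_dist A B = hausdorff_dist B A"
  unfolding hausdorff_dist_def by (auto simp: max.commute)

lemma hausdorff_dist_leI:
  assumes "A \<noteq> {}" "B \<noteq> {}" "\<And>x. x \<in> A \<Longrightarrow> infdist x B \<le> e" "\<And>x. x \<in> B \<Longrightarrow> infdist x A \<le> e"
    and "0 \<le> e"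
  shows "hausdorff_dist A B \<le> e"
  using assms unfolding hausdorff_dist_def by (auto intro!: cSUP_least)

lemma hausdorff_dist_nonneg: "0 \<le> hausdorff_dist A B"
proof (cases "A \<noteq> {} \<and> B \<noteq> {} \<and> bounded A \<and> bounded B")
  case True
  then obtain x where "x \<in> A" by blast
  with True have "infdist x B \<le> hausdorff_dist A B"
    by (intro infdist_le_hausdorff_dist) auto
  then show ?thesis using infdist_nonneg[of x B] by linarith
qed (auto simp: hausdorff_dist_def)

lemma compact_infdist_attained:
  fixes L :: "'a::metric_space set"
  assumes "compact L" "L \<noteq> {}"
  obtains y where "y \<in> L" "infdist x L = dist x y"
proof -
  have "continuous_on L (\<lambda>y. dist x y)"
    by (intro continuous_intros)
  then obtain y where y: "y \<in> L" "\<And>z. z \<in> L \<Longrightarrow> dist x y \<le> dist x z"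
    using continuous_attains_inf[OF assms] by blast
  have "dist x y \<le> infdist x L"
    unfolding infdist_notempty[OF assms(2)] by (rule cINF_greatest[OF assms(2) y(2)])
  then show thesis
    using that[OF y(1)] infdist_le[OF y(1), of x] by simp
qed

lemma infdist_triangle_hausdorff_dist:
  assumes "K \<in> nonempty_compacts B" "L \<in> nonempty_compacts B" "N \<in> nonempty_compacts B"
    and "x \<in> K"
  shows "infdist x N \<le> hausdorff_dist K L + hausdorff_dist L N"
proof -
  have *: "compact K" "K \<noteq> {}" "compact L" "L \<noteq> {}" "compact N" "N \<noteq> {}"
    using assms by (auto simp: nonempty_compacts_def)
  obtain y where y: "y \<in> L" "infdist x L = dist x y"
    by (rule compact_infdist_attained[OF \<open>compact L\<close> \<open>L \<noteq> {}\<close>])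
  have "infdist x N \<le> infdist y N + dist x y" by (rule infdist_triangle)
  also have "infdist y N \<le> hausdorff_dist L N"
    by (intro infdist_le_hausdorff_dist compact_imp_bounded * y)
  also have "dist x y \<le> hausdorff_dist K L"
    unfolding y(2)[symmetric]
    by (intro infdist_le_hausdorff_dist compact_imp_bounded * assms(4))
  finally show ?thesis by linarith
qed

lemma Metric_space_hausdorff_dist:
  "Metric_space (nonempty_compacts (B :: 'a::metric_space set)) hausdorff_dist"
proof
  fix K L N :: "'a set"
  show "0 \<le> hausdorff_dist K L" by (rule hausdorff_dist_nonneg)
  show "hausdorff_dist K L = hausdorff_dist L K" by (rule hausdorff_dist_commute)
  {
    assume KL: "K \<in> nonempty_compacts B" "L \<in> nonempty_compacts B"
    then have *: "compact K" "K \<noteq> {}" "compact L" "L \<noteq> {}"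
      by (auto simp: nonempty_compacts_def)
    have sub: "P \<subseteq> Q" if "hausdorff_dist P Q = 0" "compact P" "compact Q" "Q \<noteq> {}"
      for P Q :: "'a set"
    proof
      fix x assume "x \<in> P"
      then have "infdist x Q \<le> 0"
        using infdist_le_hausdorff_dist[OF compact_imp_bounded[OF that(2)]
            compact_imp_bounded[OF that(3)] that(4)] that(1) by simp
      then have "infdist x Q = 0" using infdist_nonneg[of x Q] by linarith
      then show "x \<in> Q"
        using in_closed_iff_infdist_zero[OF compact_imp_closed[OF that(3)] that(4)] by simp
    qed
    show "hausdorff_dist K L = 0 \<longleftrightarrow> K = L"
    proof
      assume "hausdorff_dist K L = 0"
      then show "K = L"
        using sub[of K L] sub[of L K] * hausdorff_dist_commute[of K L] by force
    next
      assume "K = L"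
      then have "hausdorff_dist K L \<le> 0"
        using * by (intro hausdorff_dist_leI) auto
      then show "hausdorff_dist K L = 0" using hausdorff_dist_nonneg[of K L] by linarith
    qed
    assume N: "N \<in> nonempty_compacts B"
    show "hausdorff_dist K N \<le> hausdorff_dist K L + hausdorff_dist L N"
    proof (rule hausdorff_dist_leI)
      show "K \<noteq> {}" "N \<noteq> {}" using * N by (auto simp: nonempty_compacts_def)
      show "infdist x N \<le> hausdorff_dist K L + hausdorff_dist L N" if "x \<in> K" for x
        by (rule infdist_triangle_hausdorff_dist[OF KL N that])
      show "infdist x K \<le> hausdorff_dist K L + hausdorff_dist L N" if "x \<in> N" for x
        using infdist_triangle_hausdorff_dist[OF N KL(2,1) that]
        by (simp add: hausdorff_dist_commute)
      show "0 \<le> hausdorff_dist K L + hausdorff_dist L N"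
        by (simp add: hausdorff_dist_nonneg)
    qed
  }
qed

lemma topspace_compacts_topology [simp]:
  "topspace (compacts_topology B) = nonempty_compacts B"
  by (simp add: compacts_topology_def Metric_space.topspace_mtopology[OF Metric_space_hausdorff_dist])


subsection \<open>Holomorphic functions with locally uniform convergence\<close>

text \<open>The elements are set to \<^term>\<open>undefined\<close> outside \<^term>\<open>S\<close>, so that two of them are equal iff
  they agree on \<^term>\<open>S\<close>.\<close>

definition holo_space :: "complex set \<Rightarrow> (complex \<Rightarrow> complex) set"
  where "holo_space S = {g. g holomorphic_on S} \<inter> extensional S"

definition holo_nhd :: "complex set \<Rightarrow> (complex \<Rightarrow> complex) \<Rightarrow> complex set \<Rightarrow> real \<Rightarrow> (complex \<Rightarrow> complex) set"
  where "holo_nhd S g K e = {h \<in> holo_space S. \<forall>z\<in>K. dist (h z) (g z) < e}"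

text \<open>For open \<^term>\<open>S\<close>, locally uniform convergence on \<^term>\<open>S\<close> is uniform convergence on the compact
  subsets of \<^term>\<open>S\<close>; see \<open>limitin_holo_topology\<close> below.\<close>

definition holo_topology :: "complex set \<Rightarrow> (complex \<Rightarrow> complex) topology"
  where "holo_topology S = topology (\<lambda>W. W \<subseteq> holo_space S \<and>
    (\<forall>g\<in>W. \<exists>K e. compact K \<and> K \<subseteq> S \<and> 0 < e \<and> holo_nhd S g K e \<subseteq> W))"

lemma holo_nhd_Un_subset:
  "holo_nhd S g (K1 \<union> K2) (min e1 e2) \<subseteq> holo_nhd S g K1 e1 \<inter> holo_nhd S g K2 e2"
  unfolding holo_nhd_def by (intro subsetI) simp

lemma istopology_holo:
  "istopology (\<lambda>W. W \<subseteq> holo_space S \<and>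
    (\<forall>g\<in>W. \<exists>K e. compact K \<and> K \<subseteq> S \<and> 0 < e \<and> holo_nhd S g K e \<subseteq> W))"
  unfolding istopology_def
proof (intro conjI allI impI ballI)
  fix W1 W2 g
  assume W1: "W1 \<subseteq> holo_space S \<and>
      (\<forall>g\<in>W1. \<exists>K e. compact K \<and> K \<subseteq> S \<and> 0 < e \<and> holo_nhd S g K e \<subseteq> W1)"
    and W2: "W2 \<subseteq> holo_space S \<and>
      (\<forall>g\<in>W2. \<exists>K e. compact K \<and> K \<subseteq> S \<and> 0 < e \<and> holo_nhd S g K e \<subseteq> W2)"
  show "W1 \<inter> W2 \<subseteq> holo_space S" using W1 by (rule conjunct1[THEN le_infI1])
  assume "g \<in> W1 \<inter> W2"
  then have g: "g \<in> W1" "g \<in> W2" by simp_all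
  obtain K1 e1 where 1: "compact K1" "K1 \<subseteq> S" "0 < e1" "holo_nhd S g K1 e1 \<subseteq> W1"
    using bspec[OF conjunct2[OF W1] g(1)] by (elim exE conjE)
  obtain K2 e2 where 2: "compact K2" "K2 \<subseteq> S" "0 < e2" "holo_nhd S g K2 e2 \<subseteq> W2"
    using bspec[OF conjunct2[OF W2] g(2)] by (elim exE conjE)
  have "holo_nhd S g (K1 \<union> K2) (min e1 e2) \<subseteq> W1 \<inter> W2"
    using holo_nhd_Un_subset Int_mono[OF 1(4) 2(4)] by (rule order_trans)
  moreover have "compact (K1 \<union> K2)" "K1 \<union> K2 \<subseteq> S" "0 < min e1 e2"
    using 1 2 by (simp_all add: compact_Un)
  ultimately show "\<exists>K e. compact K \<and> K \<subseteq> S \<and> 0 < e \<and> holo_nhd S g K e \<subseteq> W1 \<inter> W2"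
    by (intro exI conjI)
next
  fix \<W> :: "(complex \<Rightarrow> complex) set set"
  assume W: "\<forall>W\<in>\<W>. W \<subseteq> holo_space S \<and>
      (\<forall>g\<in>W. \<exists>K e. compact K \<and> K \<subseteq> S \<and> 0 < e \<and> holo_nhd S g K e \<subseteq> W)"
  show "\<Union>\<W> \<subseteq> holo_space S"
    by (rule Union_least) (rule conjunct1[OF bspec[OF W]])
  fix g assume "g \<in> \<Union>\<W>"
  then obtain W0 where W0: "W0 \<in> \<W>" "g \<in> W0" by (rule UnionE)
  obtain K e where K: "compact K" "K \<subseteq> S" "0 < e" "holo_nhd S g K e \<subseteq> W0"
    using bspec[OF conjunct2[OF bspec[OF W W0(1)]] W0(2)] by (elim exE conjE)
  have "holo_nhd S g K e \<subseteq> \<Union>\<W>"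
    using K(4) Union_upper[OF W0(1)] by (rule order_trans)
  with K(1-3) show "\<exists>K e. compact K \<and> K \<subseteq> S \<and> 0 < e \<and> holo_nhd S g K e \<subseteq> \<Union>\<W>"
    by (intro exI conjI)
qed

lemma openin_holo_topology:
  "openin (holo_topology S) W \<longleftrightarrow> W \<subseteq> holo_space S \<and>
    (\<forall>g\<in>W. \<exists>K e. compact K \<and> K \<subseteq> S \<and> 0 < e \<and> holo_nhd S g K e \<subseteq> W)"
  unfolding holo_topology_def topology_inverse'[OF istopology_holo] by (rule refl)

lemma topspace_holo_topology [simp]: "topspace (holo_topology S) = holo_space S"
proof (rule antisym)
  show "topspace (holo_topology S) \<subseteq> holo_space S"
    using openin_holo_topology[of S "topspace (holo_topology S)"] openin_topspace by blast
  have "holo_nhd S g {} 1 \<subseteq> holo_space S" for g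
    by (auto simp: holo_nhd_def)
  then have "openin (holo_topology S) (holo_space S)"
    unfolding openin_holo_topology
    by (intro conjI ballI exI[of _ "{}"] exI[of _ "1::real"]) simp_all
  then show "holo_space S \<subseteq> topspace (holo_topology S)"
    by (rule openin_subset)
qed

lemma openin_holo_nhd:
  assumes "g \<in> holo_space S" "compact K" "K \<subseteq> S"
  shows "openin (holo_topology S) (holo_nhd S g K e)"
  unfolding openin_holo_topology
proof (intro conjI ballI)
  show "holo_nhd S g K e \<subseteq> holo_space S" by (auto simp: holo_nhd_def)
  fix h assume h: "h \<in> holo_nhd S g K e"
  show "\<exists>L r. compact L \<and> L \<subseteq> S \<and> 0 < r \<and> holo_nhd S h L r \<subseteq> holo_nhd S g K e"
  proof (cases "K = {}")
    case True
    then show ?thesis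
      by (intro exI[of _ "{}"] exI[of _ 1]) (auto simp: holo_nhd_def)
  next
    case False
    have "k holomorphic_on S" if "k \<in> {g, h}" for k
      using assms(1) h that by (auto simp: holo_nhd_def holo_space_def)
    then have "continuous_on K g" "continuous_on K h"
      by (simp_all add: continuous_on_subset[OF holomorphic_on_imp_continuous_on assms(3)])
    then have "continuous_on K (\<lambda>z. dist (h z) (g z))"
      by (intro continuous_intros)
    then obtain w where w: "w \<in> K" "\<And>z. z \<in> K \<Longrightarrow> dist (h z) (g z) \<le> dist (h w) (g w)"
      using continuous_attains_sup[OF assms(2) False] by blast
    let ?r = "e - dist (h w) (g w)"
    have "0 < ?r" using h w by (auto simp: holo_nhd_def)
    moreover have "holo_nhd S h K ?r \<subseteq> holo_nhd S g K e"
    proof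
      fix k assume k: "k \<in> holo_nhd S h K ?r"
      have "dist (k z) (g z) < e" if "z \<in> K" for z
      proof -
        have "dist (k z) (h z) < ?r" using k that by (auto simp: holo_nhd_def)
        then show ?thesis
          using w(2)[OF that] dist_triangle[of "k z" "g z" "h z"] by linarith
      qed
      then show "k \<in> holo_nhd S g K e" using k by (auto simp: holo_nhd_def)
    qed
    ultimately show ?thesis using assms by blast
  qed
qed

lemma limitin_holo_topology:
  "limitin (holo_topology S) u g F \<longleftrightarrow>
     g \<in> holo_space S \<and> (\<forall>\<^sub>F i in F. u i \<in> holo_space S) \<and>
     (\<forall>K. compact K \<and> K \<subseteq> S \<longrightarrow> uniform_limit K u g F)"
proof
  assume L: "limitin (holo_topology S) u g F"
  then have g: "g \<in> holo_space S" by (auto simp: limitin_def)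
  have ev: "\<forall>\<^sub>F i in F. u i \<in> holo_nhd S g K e" if "compact K" "K \<subseteq> S" "0 < e" for K e
  proof -
    have "g \<in> holo_nhd S g K e" using g that by (auto simp: holo_nhd_def)
    then show ?thesis using L openin_holo_nhd[OF g that(1,2)] by (auto simp: limitin_def)
  qed
  have "\<forall>\<^sub>F i in F. u i \<in> holo_space S"
    using ev[of "{}" 1] by (auto simp: holo_nhd_def)
  moreover have "uniform_limit K u g F" if "compact K" "K \<subseteq> S" for K
    unfolding uniform_limit_iff
  proof (intro allI impI)
    fix e :: real assume "0 < e"
    from ev[OF that this] show "\<forall>\<^sub>F i in F. \<forall>z\<in>K. dist (u i z) (g z) < e"
      by (rule eventually_mono) (simp add: holo_nhd_def)
  qed
  ultimately show "g \<in> holo_space S \<and> (\<forall>\<^sub>F i in F. u i \<in> holo_space S) \<and>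
     (\<forall>K. compact K \<and> K \<subseteq> S \<longrightarrow> uniform_limit K u g F)"
    using g by blast
next
  assume R: "g \<in> holo_space S \<and> (\<forall>\<^sub>F i in F. u i \<in> holo_space S) \<and>
     (\<forall>K. compact K \<and> K \<subseteq> S \<longrightarrow> uniform_limit K u g F)"
  show "limitin (holo_topology S) u g F"
    unfolding limitin_def
  proof (intro conjI allI impI)
    show "g \<in> topspace (holo_topology S)" using R by simp
    fix W assume "openin (holo_topology S) W \<and> g \<in> W"
    then obtain K e where K: "compact K" "K \<subseteq> S" "0 < e" "holo_nhd S g K e \<subseteq> W"
      unfolding openin_holo_topology by blast
    then have "\<forall>\<^sub>F i in F. \<forall>z\<in>K. dist (u i z) (g z) < e"
      using R by (auto simp: uniform_limit_iff)
    moreover have "\<forall>\<^sub>F i in F. u i \<in> holo_space S" using R by blast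
    ultimately show "\<forall>\<^sub>F i in F. u i \<in> W"
    proof eventually_elim
      case (elim i)
      then have "u i \<in> holo_nhd S g K e" by (simp add: holo_nhd_def)
      then show ?case using K(4) by blast
    qed
  qed
qed


subsection \<open>The space of continuous functions on a compact set\<close>

text \<open>As before, functions are set to \<^term>\<open>undefined\<close> outside \<^term>\<open>K\<close>.\<close>

definition cont_space :: "complex set \<Rightarrow> (complex \<Rightarrow> complex) set"
  where "cont_space K = {h. continuous_on K h} \<inter> extensional K"

text \<open>Again the value 0 is a convention which does not matter for non-empty compact
  \<^term>\<open>K\<close> and continuous functions.\<close>

definition sup_dist :: "complex set \<Rightarrow> (complex \<Rightarrow> complex) \<Rightarrow> (complex \<Rightarrow> complex) \<Rightarrow> real"
  where "sup_dist K g h =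
    (if K \<noteq> {} \<and> bdd_above ((\<lambda>z. norm (g z - h z)) ` K) then SUP z\<in>K. norm (g z - h z) else 0)"

definition cont_topology :: "complex set \<Rightarrow> (complex \<Rightarrow> complex) topology"
  where "cont_topology K = Metric_space.mtopology (cont_space K) (sup_dist K)"

lemma norm_le_sup_dist:
  assumes "compact K" "g \<in> cont_space K" "h \<in> cont_space K" "z \<in> K"
  shows "norm (g z - h z) \<le> sup_dist K g h"
proof -
  have "continuous_on K (\<lambda>z. norm (g z - h z))"
    using assms by (auto simp: cont_space_def intro!: continuous_intros)
  then have b: "bdd_above ((\<lambda>z. norm (g z - h z)) ` K)"
    using assms(1) by (intro bounded_imp_bdd_above compact_imp_bounded compact_continuous_image)
  have "norm (g z - h z) \<le> (SUP z\<in>K. norm (g z - h z))"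
    by (rule cSUP_upper[OF assms(4) b])
  then show ?thesis using b assms(4) unfolding sup_dist_def by auto
qed

lemma sup_dist_leI:
  assumes "\<And>z. z \<in> K \<Longrightarrow> norm (g z - h z) \<le> e" "0 \<le> e"
  shows "sup_dist K g h \<le> e"
  using assms unfolding sup_dist_def by (auto intro!: cSUP_least)

lemma sup_dist_nonneg: "0 \<le> sup_dist K g h"
proof (cases "K \<noteq> {} \<and> bdd_above ((\<lambda>z. norm (g z - h z)) ` K)")
  case True
  then obtain z where "z \<in> K" by blast
  then have "norm (g z - h z) \<le> (SUP z\<in>K. norm (g z - h z))"
    using True by (intro cSUP_upper) auto
  then have "0 \<le> (SUP z\<in>K. norm (g z - h z))"
    using norm_ge_zero[of "g z - h z"] by linarith
  with True show ?thesis unfolding sup_dist_def by auto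
qed (auto simp: sup_dist_def)

lemma Metric_space_sup_dist:
  assumes "compact K"
  shows "Metric_space (cont_space K) (sup_dist K)"
proof
  fix g h k
  show "0 \<le> sup_dist K g h" by (rule sup_dist_nonneg)
  show "sup_dist K g h = sup_dist K h g" unfolding sup_dist_def by (simp add: norm_minus_commute)
  {
    assume gh: "g \<in> cont_space K" "h \<in> cont_space K"
    show "sup_dist K g h = 0 \<longleftrightarrow> g = h"
    proof
      assume "sup_dist K g h = 0"
      then have "g z = h z" if "z \<in> K" for z
        using norm_le_sup_dist[OF assms gh that] by simp
      then show "g = h"
        using gh by (intro extensionalityI[of g K h]) (auto simp: cont_space_def)
    next
      assume "g = h"
      then have "sup_dist K g h \<le> 0" by (intro sup_dist_leI) auto
      then show "sup_dist K g h = 0" using sup_dist_nonneg[of K g h] by linarith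
    qed
    assume k: "k \<in> cont_space K"
    show "sup_dist K g k \<le> sup_dist K g h + sup_dist K h k"
    proof (rule sup_dist_leI)
      fix z assume z: "z \<in> K"
      have "norm (g z - k z) \<le> norm (g z - h z) + norm (h z - k z)"
        using norm_triangle_ineq[of "g z - h z" "h z - k z"] by simp
      then show "norm (g z - k z) \<le> sup_dist K g h + sup_dist K h k"
        using norm_le_sup_dist[OF assms gh z] norm_le_sup_dist[OF assms gh(2) k z] by linarith
    qed (simp add: sup_dist_nonneg)
  }
qed

lemma topspace_cont_topology [simp]:
  "compact K \<Longrightarrow> topspace (cont_topology K) = cont_space K"
  by (simp add: cont_topology_def Metric_space.topspace_mtopology[OF Metric_space_sup_dist])


subsection \<open>Universal functions for composition operators\<close>

definition CK_universal ::
    "(complex \<Rightarrow> complex) \<Rightarrow> complex set \<Rightarrow> complex \<Rightarrow> complex set \<Rightarrow> (complex \<Rightarrow> complex) \<Rightarrow> bool"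
  where "CK_universal f U z0 K g \<longleftrightarrow>
    K \<subseteq> U - {z0} \<and>
    cont_topology K closure_of {restrict (g \<circ> (f ^^ n)) K | n. 1 \<le> n} = topspace (cont_topology K)"

end

theory Submission
  imports Defs "HOL-Complex_Analysis.Complex_Analysis"
begin

text \<open>
The idea is to correct a given function \<open>g0\<close>, holomorphic off \<open>z0\<close>, by a function
\<open>P (1 / (w - z0))\<close> with \<open>P\<close> entire: this stays holomorphic off \<open>z0\<close>, it is small on a given compact
set \<open>L\<close> if \<open>P\<close> is small on a disc that contains the points \<open>1 / (w - z0)\<close>, \<open>w \<in> L\<close>, and the values of
\<open>P\<close> outside this disc are still at our disposal. In Boettcher's coordinate the iterates of \<open>f\<close> are
\<open>\<zeta> \<mapsto> \<zeta> ^ (p ^ n)\<close> on a disc of radius \<open>\<delta> < 1\<close>. Hence they converge to \<open>z0\<close> uniformly on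
\<open>B = {z \<in> U. \<phi> z \<in> cball 0 \<delta>}\<close>, so that \<open>1 / ((f ^^ n) z - z0)\<close> is outside the disc for large \<open>n\<close>,
and they have finite fibres.

What is needed of \<open>K\<close> is that, for such \<open>n\<close>, every continuous function on \<open>K\<close> is uniformly close to
some \<open>P (1 / ((f ^^ n) z - z0))\<close> with \<open>P\<close> small on the disc (\<open>correctable\<close>). For a finite set on which
\<open>f ^^ n\<close> is injective and avoids \<open>z0\<close>, this is Lagrange interpolation multiplied by high powers
(\<open>interpolation_small_on_disc\<close>). Such finite sets are dense among the compact subsets of \<open>B\<close>, because
\<open>B\<close> has no isolated points and the fibres of \<open>f ^^ n\<close> are finite (\<open>finite_approximation_injective\<close>).
For one target function and one precision the condition is also open in \<open>K\<close>, and therefore generic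
by Baire's theorem in the complete space of compact subsets of \<open>B\<close>. Only countably many conditions
can be imposed in this way, while the targets that occur below depend on arbitrary functions \<open>g0\<close>.
But the functions that can be approximated arbitrarily well form a closed algebra, since products
of small functions are small. By Stone and Weierstrass the three targets \<open>1\<close>, \<open>Re\<close>, \<open>Im\<close> already give all continuous
functions on \<open>K\<close> (\<open>approximable_pullback\<close>, \<open>comeager_in_correctable\<close>).

For such a \<open>K\<close> and a continuous target \<open>u\<close>, the correction is applied to \<open>u - g0 \<circ> f ^^ n\<close>. This shows
that the functions \<open>g\<close> for which some \<open>g \<circ> f ^^ n\<close> is close to \<open>u\<close> on \<open>K\<close> form a dense open set. Since
\<open>C(K)\<close> is separable, Baire's theorem in the space of holomorphic functions yields comeager many
universal functions.\<close>

lemma comeager_in_mono: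
  assumes "comeager_in X A" "A \<subseteq> B" "B \<subseteq> topspace X"
  shows "comeager_in X B"
  using assms unfolding comeager_in_def by (meson subset_trans)

section \<open>The space of compact sets\<close>

text \<open>A compact subset of an open set has positive distance to the complement, and sets that are closer
to it than this in the Hausdorff distance remain inside.\<close>

lemma openin_compacts_subset:
  fixes O' :: "'a::heine_borel set"
  assumes "open O'"
  shows "openin (compacts_topology B) {K \<in> nonempty_compacts B. K \<subseteq> O'}"
proof -
  interpret H: Metric_space "nonempty_compacts B" hausdorff_dist
    by (rule Metric_space_hausdorff_dist)
  show ?thesis
    unfolding compacts_topology_def H.openin_mtopology
  proof (intro conjI allI impI)
    fix K assume "K \<in> {K \<in> nonempty_compacts B. K \<subseteq> O'}"
    then have K: "compact K" "K \<noteq> {}" "K \<subseteq> O'" by (auto simp: nonempty_compacts_def)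
    obtain e where e: "e > 0" "{x. infdist x K \<le> e} \<subseteq> O'"
      using compact_in_open_separated[OF K(2,1) assms K(3)] by blast
    have "L \<subseteq> O'" if "L \<in> H.mball K e" for L
    proof
      fix x assume "x \<in> L"
      have L: "compact L" "hausdorff_dist L K < e"
        using that unfolding H.in_mball
        by (simp_all add: hausdorff_dist_commute) (simp add: nonempty_compacts_def)
      have "infdist x K \<le> hausdorff_dist L K"
        by (intro infdist_le_hausdorff_dist compact_imp_bounded L K \<open>x \<in> L\<close>)
      with L(2) e(2) show "x \<in> O'" by force
    qed
    then have "H.mball K e \<subseteq> {K \<in> nonempty_compacts B. K \<subseteq> O'}"
      unfolding H.mball_def by blast
    with e(1) show "\<exists>r>0. H.mball K r \<subseteq> {K \<in> nonempty_compacts B. K \<subseteq> O'}"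
      by blast
  qed auto
qed

lemma dense_compacts_iff:
  assumes "\<A> \<subseteq> nonempty_compacts B"
  shows "compacts_topology B closure_of \<A> = nonempty_compacts B \<longleftrightarrow>
    (\<forall>K\<in>nonempty_compacts B. \<forall>e>0. \<exists>L\<in>\<A>. hausdorff_dist K L < e)"
proof -
  interpret H: Metric_space "nonempty_compacts B" hausdorff_dist
    by (rule Metric_space_hausdorff_dist)
  show ?thesis
    using assms unfolding compacts_topology_def H.metric_closure_of by fastforce
qed

text \<open>The Hausdorff distance is a uniform bound on the difference of the distance functions. Thus
Cauchy sequences of compact sets turn into uniformly convergent sequences of functions.\<close>

lemma abs_infdist_diff_le_hausdorff_dist:
  fixes K L :: "'a::metric_space set"
  assumes "compact K" "K \<noteq> {}" "compact L" "L \<noteq> {}"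
  shows "\<bar>infdist x K - infdist x L\<bar> \<le> hausdorff_dist K L"
proof -
  have le: "infdist x K \<le> infdist x L + hausdorff_dist L K"
    if KL: "compact K" "K \<noteq> {}" "compact L" "L \<noteq> {}" for K L :: "'a set"
  proof -
    obtain y where y: "y \<in> L" "infdist x L = dist x y"
      by (rule compact_infdist_attained[OF KL(3,4)])
    have "infdist x K \<le> infdist y K + dist x y" by (rule infdist_triangle)
    also have "infdist y K \<le> hausdorff_dist L K"
      by (intro infdist_le_hausdorff_dist compact_imp_bounded KL y)
    finally show ?thesis using y by simp
  qed
  from le[OF assms] le[OF assms(3,4,1,2)] show ?thesis
    by (simp add: hausdorff_dist_commute abs_le_iff)
qed

text \<open>The distance functions of a Cauchy sequence converge uniformly, and the zero set of their limit is
the only candidate for the limit set. Compactness of \<open>B\<close> supplies enough points of that set: a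
sequence of nearest points in the later sets has a cluster point, which is a zero.\<close>

lemma mcomplete_hausdorff_dist:
  fixes B :: "'a::heine_borel set"
  assumes "compact B"
  shows "Metric_space.mcomplete (nonempty_compacts B) hausdorff_dist"
proof -
  interpret H: Metric_space "nonempty_compacts B" hausdorff_dist
    by (rule Metric_space_hausdorff_dist)
  have "\<exists>L. limitin H.mtopology \<sigma> L sequentially" if "H.MCauchy \<sigma>" for \<sigma>
  proof -
    have mem: "\<sigma> n \<in> nonempty_compacts B" for n
      using that by (auto simp: H.MCauchy_def)
    then have \<sigma>: "compact (\<sigma> n)" "\<sigma> n \<noteq> {}" "\<sigma> n \<subseteq> B" for n
      by (simp_all add: nonempty_compacts_def)
    have cau: "\<exists>N. \<forall>m\<ge>N. \<forall>n\<ge>N. hausdorff_dist (\<sigma> m) (\<sigma> n) < e" if "e > 0" for e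
    proof -
      have "\<forall>e>0. \<exists>N. \<forall>m n. N \<le> m \<longrightarrow> N \<le> n \<longrightarrow> hausdorff_dist (\<sigma> m) (\<sigma> n) < e"
        using \<open>H.MCauchy \<sigma>\<close> unfolding H.MCauchy_def by (rule conjunct2)
      with that show ?thesis by meson
    qed
    have near: "\<bar>infdist x (\<sigma> m) - infdist x (\<sigma> n)\<bar> \<le> hausdorff_dist (\<sigma> m) (\<sigma> n)" for x m n
      by (intro abs_infdist_diff_le_hausdorff_dist \<sigma>)
    have "Cauchy (\<lambda>n. infdist x (\<sigma> n))" for x
      unfolding Cauchy_def dist_real_def using cau near by (meson le_less_trans)
    then have "\<exists>l. (\<lambda>n. infdist x (\<sigma> n)) \<longlonglongrightarrow> l" for x
      by (simp add: Cauchy_convergent convergent_def[symmetric])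
    then obtain d where d: "\<And>x. (\<lambda>n. infdist x (\<sigma> n)) \<longlonglongrightarrow> d x"
      by metis
    have d_near: "\<bar>infdist x (\<sigma> n) - d x\<bar> \<le> e"
      if "\<And>m. m \<ge> n \<Longrightarrow> hausdorff_dist (\<sigma> n) (\<sigma> m) < e" for x n e
    proof (rule LIMSEQ_le_const2)
      show "(\<lambda>m. \<bar>infdist x (\<sigma> n) - infdist x (\<sigma> m)\<bar>) \<longlonglongrightarrow> \<bar>infdist x (\<sigma> n) - d x\<bar>"
        by (intro tendsto_intros d)
      show "\<exists>N. \<forall>m\<ge>N. \<bar>infdist x (\<sigma> n) - infdist x (\<sigma> m)\<bar> \<le> e"
        using near that by (meson le_less_trans less_imp_le)
    qed
    define L where "L = {x \<in> B. d x = 0}"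
    have approx: "\<exists>y\<in>L. dist x y \<le> e"
      if n: "\<And>m. m \<ge> n \<Longrightarrow> hausdorff_dist (\<sigma> n) (\<sigma> m) < e" and x: "x \<in> \<sigma> n" for x n e
    proof -
      have "\<exists>y\<in>\<sigma> m. infdist x (\<sigma> m) = dist x y" for m
        using compact_infdist_attained[OF \<sigma>(1,2)] by metis
      then obtain Y where Y: "\<And>m. Y m \<in> \<sigma> m" "\<And>m. infdist x (\<sigma> m) = dist x (Y m)"
        by metis
      have "\<forall>m. Y m \<in> B" using Y(1) \<sigma>(3) by blast
      then obtain y r where y: "y \<in> B" "strict_mono r" "(Y \<circ> r) \<longlonglongrightarrow> y"
        using assms unfolding compact_def by blast
      have "(\<lambda>k. infdist y (\<sigma> (r k))) \<longlonglongrightarrow> d y"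
        using LIMSEQ_subseq_LIMSEQ[OF d y(2)] by (simp add: o_def)
      moreover have "(\<lambda>k. infdist y (\<sigma> (r k))) \<longlonglongrightarrow> 0"
      proof (rule tendsto_sandwich[where f = "\<lambda>_. 0"])
        show "(\<lambda>k. dist y (Y (r k))) \<longlonglongrightarrow> 0"
          using tendsto_dist[OF tendsto_const[of y] y(3)] by (simp add: o_def)
        show "\<forall>\<^sub>F k in sequentially. infdist y (\<sigma> (r k)) \<le> dist y (Y (r k))"
          using Y(1) by (intro always_eventually allI infdist_le)
      qed (auto simp: infdist_nonneg)
      ultimately have "d y = 0" using LIMSEQ_unique by blast
      moreover have "dist x y \<le> e"
      proof (rule LIMSEQ_le_const2)
        show "(\<lambda>k. dist x (Y (r k))) \<longlonglongrightarrow> dist x y"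
          using tendsto_dist[OF tendsto_const[of x] y(3)] by (simp add: o_def)
        have "dist x (Y (r k)) \<le> e" if "k \<ge> n" for k
        proof -
          have "r k \<ge> n" using that seq_suble[OF y(2), of k] by linarith
          then have "\<bar>infdist x (\<sigma> n) - infdist x (\<sigma> (r k))\<bar> < e"
            using near n by (meson le_less_trans)
          with x Y(2)[of "r k"] show ?thesis by (simp add: infdist_zero)
        qed
        then show "\<exists>N. \<forall>k\<ge>N. dist x (Y (r k)) \<le> e" by blast
      qed
      ultimately show ?thesis using y(1) by (auto simp: L_def)
    qed
    obtain n1 where n1: "\<And>m. m \<ge> n1 \<Longrightarrow> hausdorff_dist (\<sigma> n1) (\<sigma> m) < 1"
      using cau[of 1] by auto
    then have "L \<noteq> {}" using approx \<sigma>(2)[of n1] by blast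
    have "\<bar>d x - d y\<bar> \<le> dist x y" for x y
    proof (rule LIMSEQ_le_const2)
      show "(\<lambda>m. \<bar>infdist x (\<sigma> m) - infdist y (\<sigma> m)\<bar>) \<longlonglongrightarrow> \<bar>d x - d y\<bar>"
        by (intro tendsto_intros d)
      show "\<exists>N. \<forall>m\<ge>N. \<bar>infdist x (\<sigma> m) - infdist y (\<sigma> m)\<bar> \<le> dist x y"
        using infdist_triangle_abs by blast
    qed
    then have "continuous_on B d"
      unfolding continuous_on_iff dist_real_def by (metis le_less_trans dist_commute)
    then have "closed L"
      unfolding L_def by (rule continuous_closed_preimage_constant[OF _ compact_imp_closed[OF assms]])
    then have "compact (B \<inter> L)"
      by (rule compact_Int_closed[OF assms])
    moreover have "B \<inter> L = L"
      by (auto simp: L_def)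
    ultimately have "compact L" by simp
    with \<open>L \<noteq> {}\<close> have L: "L \<in> nonempty_compacts B"
      by (auto simp: nonempty_compacts_def L_def)
    have "limitin H.mtopology \<sigma> L sequentially"
      unfolding H.limit_metric_sequentially
    proof (intro conjI allI impI L)
      fix e :: real assume "e > 0"
      then obtain N where N: "\<And>m n. m \<ge> N \<Longrightarrow> n \<ge> N \<Longrightarrow> hausdorff_dist (\<sigma> m) (\<sigma> n) < e / 2"
        using cau[of "e/2"] by auto
      have "hausdorff_dist (\<sigma> n) L < e" if "n \<ge> N" for n
      proof -
        have n: "hausdorff_dist (\<sigma> n) (\<sigma> m) < e / 2" if "m \<ge> n" for m
          using N \<open>n \<ge> N\<close> that by simp
        have "hausdorff_dist (\<sigma> n) L \<le> e / 2"
        proof (rule hausdorff_dist_leI[OF \<sigma>(2) \<open>L \<noteq> {}\<close>])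
          show "infdist x L \<le> e / 2" if "x \<in> \<sigma> n" for x
            using approx[OF n that] by (meson infdist_le2)
          show "infdist x (\<sigma> n) \<le> e / 2" if "x \<in> L" for x
            using d_near[OF n, of x] that by (simp add: L_def)
        qed (use \<open>e > 0\<close> in simp)
        with \<open>e > 0\<close> show ?thesis by linarith
      qed
      with mem show "\<exists>N. \<forall>n\<ge>N. \<sigma> n \<in> nonempty_compacts B \<and> hausdorff_dist (\<sigma> n) L < e"
        by blast
    qed
    then show ?thesis by blast
  qed
  then show ?thesis unfolding H.mcomplete_def by blast
qed

text \<open>The form of Baire's theorem in which genericity of compact sets is used: density is stated by
approximation in the Hausdorff distance.\<close>

lemma comeager_in_compacts_INT:
  fixes B :: "'a::heine_borel set"
  assumes "compact B" "countable I" "I \<noteq> {}"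
    and "\<And>i. i \<in> I \<Longrightarrow> openin (compacts_topology B) (\<A> i)"
    and "\<And>i K e. i \<in> I \<Longrightarrow> K \<in> nonempty_compacts B \<Longrightarrow> 0 < e \<Longrightarrow> \<exists>L\<in>\<A> i. hausdorff_dist K L < e"
    and "(\<Inter>i\<in>I. \<A> i) \<subseteq> \<B>" "\<B> \<subseteq> nonempty_compacts B"
  shows "comeager_in (compacts_topology B) \<B>"
proof -
  interpret H: Metric_space "nonempty_compacts B" hausdorff_dist
    by (rule Metric_space_hausdorff_dist)
  have sub: "\<A> i \<subseteq> nonempty_compacts B" if "i \<in> I" for i
    using openin_subset[OF assms(4)[OF that]] by simp
  have "compacts_topology B closure_of \<A> i = nonempty_compacts B" if "i \<in> I" for i
    using assms(5)[OF that] dense_compacts_iff[OF sub[OF that]] by blast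
  then have "H.mtopology closure_of \<Inter>(\<A> ` I) = nonempty_compacts B"
    using assms(2,4) mcomplete_hausdorff_dist[OF assms(1)]
    by (intro H.metric_Baire_category) (auto simp: compacts_topology_def)
  moreover have "gdelta_in (compacts_topology B) (\<Inter>(\<A> ` I))"
    using assms(2-4) by (intro gdelta_in_Inter) (auto intro: open_imp_gdelta_in)
  ultimately show ?thesis
    using assms(6,7) unfolding comeager_in_def topspace_compacts_topology
    by (auto simp: compacts_topology_def intro!: exI[of _ "\<Inter>(\<A> ` I)"])
qed

text \<open>Take a finite net of \<open>K\<close> and move its points one after the other: near each of them there are
infinitely many points of \<open>B\<close>, of which only finitely many lie in the fibres over \<open>c\<close> and over the
values taken so far.\<close>

lemma finite_approximation_injective:
  fixes w :: "'a::metric_space \<Rightarrow> 'b"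
  assumes K: "compact K" "K \<noteq> {}" "K \<subseteq> B" and "0 < e"
    and perfect: "\<And>x. x \<in> B \<Longrightarrow> x islimpt B"
    and fibres: "\<And>y. finite {x \<in> B. w x = y}"
  obtains F where "finite F" "F \<noteq> {}" "F \<subseteq> B" "inj_on w F" "c \<notin> w ` F" "hausdorff_dist K F < e"
proof -
  obtain A where A: "finite A" "A \<subseteq> K" "K \<subseteq> (\<Union>a\<in>A. ball a (e / 4))"
    using compactE_image[OF K(1), of K "\<lambda>a. ball a (e / 4)"] \<open>0 < e\<close>
    by (metis UN_I centre_in_ball open_ball subsetI divide_pos_pos zero_less_numeral)
  have "\<exists>F. finite F \<and> F \<subseteq> B \<and> inj_on w F \<and> c \<notin> w ` F \<and>
     (\<forall>a\<in>A. \<exists>b\<in>F. dist a b < e / 4) \<and> (\<forall>b\<in>F. \<exists>a\<in>A. dist a b < e / 4)"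
    using A(1) subset_trans[OF A(2) K(3)]
  proof (induction A rule: finite_induct)
    case empty
    then show ?case by (intro exI[of _ "{}"]) auto
  next
    case (insert a A)
    then obtain F where F: "finite F" "F \<subseteq> B" "inj_on w F" "c \<notin> w ` F"
      "\<forall>a\<in>A. \<exists>b\<in>F. dist a b < e / 4" "\<forall>b\<in>F. \<exists>a\<in>A. dist a b < e / 4"
      by auto
    let ?bad = "\<Union>y\<in>insert c (w ` F). {x \<in> B. w x = y}"
    have "finite ?bad" using F(1) fibres by auto
    moreover have "infinite (B \<inter> ball a (e / 4))"
      using perfect[of a] insert.prems \<open>0 < e\<close> by (simp add: islimpt_eq_infinite_ball)
    ultimately have "infinite (B \<inter> ball a (e / 4) - ?bad)"
      by (rule Diff_infinite_finite)
    then have "B \<inter> ball a (e / 4) - ?bad \<noteq> {}"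
      by (rule infinite_imp_nonempty)
    then obtain b where "b \<in> B \<inter> ball a (e / 4)" "b \<notin> ?bad"
      by blast
    then have b: "b \<in> B" "dist a b < e / 4" "w b \<noteq> c" "w b \<notin> w ` F"
      by auto
    show ?case
    proof (intro exI[of _ "insert b F"] conjI)
      show "inj_on w (insert b F)" "finite (insert b F)" "insert b F \<subseteq> B" "c \<notin> w ` insert b F"
        using F(1-4) b by (auto simp: inj_on_insert)
      show "\<forall>a'\<in>insert a A. \<exists>b'\<in>insert b F. dist a' b' < e / 4"
        "\<forall>b'\<in>insert b F. \<exists>a'\<in>insert a A. dist a' b' < e / 4"
        using F(5,6) b(2) by blast+
    qed
  qed
  then obtain F where F: "finite F" "F \<subseteq> B" "inj_on w F" "c \<notin> w ` F"
      "\<forall>a\<in>A. \<exists>b\<in>F. dist a b < e / 4" "\<forall>b\<in>F. \<exists>a\<in>A. dist a b < e / 4"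
    by blast
  have "A \<noteq> {}" using A(3) K(2) by auto
  then have "F \<noteq> {}" using F(5) by auto
  have "hausdorff_dist K F \<le> e / 2"
  proof (rule hausdorff_dist_leI[OF K(2) \<open>F \<noteq> {}\<close>])
    fix x assume "x \<in> K"
    then obtain a where a: "a \<in> A" "dist a x < e / 4" using A(3) by auto
    then obtain b where b: "b \<in> F" "dist a b < e / 4" using F(5) by blast
    have "dist x b \<le> e / 2" using a b dist_triangle3[of x b a] by linarith
    with b show "infdist x F \<le> e / 2" by (meson infdist_le2)
  next
    fix x assume "x \<in> F"
    then obtain a where "a \<in> A" "dist a x < e / 4" using F(6) by blast
    then have "dist x a \<le> e / 2" "a \<in> K" using A(2) \<open>0 < e\<close> by (auto simp: dist_commute)
    then show "infdist x K \<le> e / 2" by (meson infdist_le2)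
  qed (use \<open>0 < e\<close> in simp)
  with F \<open>F \<noteq> {}\<close> \<open>0 < e\<close> show thesis by (intro that) auto
qed

section \<open>The space of holomorphic functions\<close>

lemma dense_holo_iff:
  assumes "\<A> \<subseteq> holo_space S"
  shows "holo_topology S closure_of \<A> = holo_space S \<longleftrightarrow>
    (\<forall>g\<in>holo_space S. \<forall>K e. compact K \<longrightarrow> K \<subseteq> S \<longrightarrow> 0 < e \<longrightarrow> \<A> \<inter> holo_nhd S g K e \<noteq> {})"
    (is "?L \<longleftrightarrow> ?R")
proof -
  have L: "?L \<longleftrightarrow> (\<forall>T. openin (holo_topology S) T \<and> T \<noteq> {} \<longrightarrow> \<A> \<inter> T \<noteq> {})"
    using dense_intersects_open[of "holo_topology S" \<A>] by simp
  show ?thesis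
  proof
    assume ?L
    show ?R
    proof (intro ballI allI impI)
      fix g K and e :: real assume *: "g \<in> holo_space S" "compact K" "K \<subseteq> S" "0 < e"
      then have "g \<in> holo_nhd S g K e" by (simp add: holo_nhd_def)
      then have "holo_nhd S g K e \<noteq> {}" by blast
      with openin_holo_nhd[OF *(1-3)] \<open>?L\<close> show "\<A> \<inter> holo_nhd S g K e \<noteq> {}"
        unfolding L by meson
    qed
  next
    assume R: ?R
    show ?L
      unfolding L
    proof (intro allI impI)
      fix T assume T: "openin (holo_topology S) T \<and> T \<noteq> {}"
      then obtain g where g: "g \<in> T" by blast
      then obtain K e where "compact K" "K \<subseteq> S" "0 < e" and sub: "holo_nhd S g K e \<subseteq> T" "g \<in> holo_space S"
        using T unfolding openin_holo_topology by blast
      then have "\<A> \<inter> holo_nhd S g K e \<noteq> {}" using R by meson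
      with sub(1) show "\<A> \<inter> T \<noteq> {}" by blast
    qed
  qed
qed

text \<open>Instead of a complete metric, the usual construction behind Baire's theorem is carried out with
the basic neighbourhoods: each neighbourhood lies in the preceding one and in the next open set,
in the strong sense of closed inequalities, which survive in the limit. The exhausting compact sets
are included in the neighbourhoods one by one, so that the centres converge locally uniformly.\<close>

lemma holo_Baire:
  fixes \<O> :: "nat \<Rightarrow> (complex \<Rightarrow> complex) set"
  assumes "open S"
    and op: "\<And>k. openin (holo_topology S) (\<O> k)"
    and dense: "\<And>k. holo_topology S closure_of \<O> k = holo_space S"
    and g0: "g0 \<in> holo_space S" and K0: "compact K0" "K0 \<subseteq> S" and e0: "0 < e0"
  shows "(\<Inter>k. \<O> k) \<inter> holo_nhd S g0 K0 e0 \<noteq> {}"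
proof -
  obtain C where C: "\<And>k. compact (C k)" "\<And>k. C k \<subseteq> S" "\<And>K. compact K \<Longrightarrow> K \<subseteq> S \<Longrightarrow> \<exists>N::nat. \<forall>k\<ge>N. K \<subseteq> C k"
    using open_Union_compact_subsets[OF \<open>open S\<close>] by metis
  \<comment> \<open>A state of the construction is a triple of centre, compact set and radius; \<open>N\<close> is its closed neighbourhood.\<close>
  define N where "N = (\<lambda>(g, K, e::real). {h \<in> holo_space S. \<forall>z\<in>K. dist (h z) (g z) \<le> e})"
  define ok where "ok = (\<lambda>(g, K, e::real). g \<in> holo_space S \<and> compact K \<and> K \<subseteq> S \<and> 0 < e)"
  define refines where "refines = (\<lambda>k (g, K, e) (g', K', e').
    C k \<subseteq> K' \<and> e' \<le> 1 / Suc k \<and> N (g', K', e') \<subseteq> \<O> k \<inter> holo_nhd S g K e)"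
  have step: "\<exists>s'. ok s' \<and> refines k s s'" if "ok s" for s k
  proof -
    obtain g K e where s: "s = (g, K, e)" by (cases s)
    have gKe: "g \<in> holo_space S" "compact K" "K \<subseteq> S" "0 < e"
      using that by (simp_all add: s ok_def)
    have sub: "\<O> k \<subseteq> holo_space S" using openin_subset[OF op] by simp
    obtain g' where g': "g' \<in> \<O> k \<inter> holo_nhd S g K e"
      using dense_holo_iff[OF sub] dense gKe by blast
    moreover have "openin (holo_topology S) (\<O> k \<inter> holo_nhd S g K e)"
      by (intro openin_Int op openin_holo_nhd gKe)
    ultimately obtain K' e' where K': "compact K'" "K' \<subseteq> S" "0 < e'"
        "holo_nhd S g' K' e' \<subseteq> \<O> k \<inter> holo_nhd S g K e"
      unfolding openin_holo_topology by blast
    \<comment> \<open>Halving the radius puts the closed neighbourhood inside the open one.\<close>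
    define e'' where "e'' = min (e' / 2) (1 / Suc k)"
    have e'': "0 < e''" "e'' < e'" "e'' \<le> 1 / Suc k" using K'(3) by (auto simp: e''_def)
    have "N (g', K' \<union> C k, e'') \<subseteq> holo_nhd S g' K' e'"
      unfolding N_def holo_nhd_def prod.case using e''(2) by (auto intro: le_less_trans)
    with K' e'' C(1,2) g' sub show ?thesis
      by (intro exI[of _ "(g', K' \<union> C k, e'')"]) (auto simp: ok_def refines_def s)
  qed
  obtain \<sigma> where \<sigma>: "\<And>k. ok (\<sigma> k)" "\<sigma> 0 = (g0, K0, e0)" "\<And>k. refines k (\<sigma> k) (\<sigma> (Suc k))"
  proof -
    have "ok (g0, K0, e0)" using g0 K0 e0 by (simp add: ok_def)
    then have "\<exists>\<sigma>. \<forall>k. (ok (\<sigma> k) \<and> (k = 0 \<longrightarrow> \<sigma> k = (g0, K0, e0))) \<and> refines k (\<sigma> k) (\<sigma> (Suc k))"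
      using step by (intro dependent_nat_choice) auto
    with that show thesis by metis
  qed
  define g where "g k = fst (\<sigma> k)" for k
  define K where "K k = fst (snd (\<sigma> k))" for k
  define e where "e k = snd (snd (\<sigma> k))" for k
  have \<sigma>_eq: "\<sigma> k = (g k, K k, e k)" for k
    by (simp add: g_def K_def e_def)
  have g: "g k \<in> holo_space S" "K k \<subseteq> S" "0 < e k" for k
    using \<sigma>(1)[of k] unfolding \<sigma>_eq ok_def by simp_all
  have CK: "C k \<subseteq> K (Suc k)" "e (Suc k) \<le> 1 / Suc k"
    and N_sub: "N (g (Suc k), K (Suc k), e (Suc k)) \<subseteq> \<O> k \<inter> holo_nhd S (g k) (K k) (e k)" for k
    using \<sigma>(3)[of k] unfolding \<sigma>_eq refines_def by simp_all
  have N_in: "h \<in> \<O> k \<inter> holo_nhd S (g k) (K k) (e k)"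
    if "h \<in> holo_space S" "\<And>z. z \<in> K (Suc k) \<Longrightarrow> dist (h z) (g (Suc k) z) \<le> e (Suc k)" for h k
    by (rule subsetD[OF N_sub]) (simp add: N_def that)
  have nested: "dist (g j z) (g k z) \<le> e k" if "k \<le> j" "z \<in> K k" for j k z
  proof -
    have "\<forall>z\<in>K k. dist (g j z) (g k z) \<le> e k"
      using that(1)
    proof (induction k rule: inc_induct)
      case base
      then show ?case using g(3) by (auto intro: less_imp_le)
    next
      case (step k)
      then have "g j \<in> holo_nhd S (g k) (K k) (e k)"
        using N_in[of "g j" k] g(1) by simp
      then show ?case by (simp add: holo_nhd_def less_imp_le)
    qed
    with that(2) show ?thesis by blast
  qed
  have cauchy: "dist (g i z) (g j z) \<le> 2 / Suc k" if "z \<in> C k" "i > k" "j > k" for i j k z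
  proof -
    have "dist (g i z) (g (Suc k) z) \<le> 1 / Suc k" if "i > k" for i
      using nested[of "Suc k" i z] CK[of k] \<open>z \<in> C k\<close> that by fastforce
    from this[OF that(2)] this[OF that(3)] have "dist (g i z) (g j z) \<le> 1 / Suc k + 1 / Suc k"
      using dist_triangle2[of "g i z" "g j z" "g (Suc k) z"] by linarith
    then show ?thesis by simp
  qed
  have unif: "uniformly_convergent_on L g" if L: "compact L" "L \<subseteq> S" for L
    unfolding uniformly_convergent_eq_Cauchy uniformly_Cauchy_on_def
  proof (intro allI impI)
    fix r :: real assume "r > 0"
    obtain n where n: "\<forall>k\<ge>n. L \<subseteq> C k" using C(3)[OF L] by blast
    obtain m :: nat where m: "2 / r < m" using reals_Archimedean2 by blast
    let ?k = "max m n"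
    have "2 / r < Suc ?k" using m by linarith
    then have lt: "2 / Suc ?k < r" using \<open>r > 0\<close> by (simp add: field_simps)
    have "dist (g i z) (g j z) < r" if "z \<in> L" "i \<ge> Suc ?k" "j \<ge> Suc ?k" for i j z
    proof (rule le_less_trans[OF cauchy])
      show "z \<in> C ?k" using n that(1) max.cobounded2[of n m] by blast
    qed (use that lt in auto)
    then show "\<exists>M. \<forall>x\<in>L. \<forall>m\<ge>M. \<forall>n\<ge>M. dist (g m x) (g n x) < r" by blast
  qed
  have "\<exists>l. (\<lambda>k. g k z) \<longlonglongrightarrow> l" if "z \<in> S" for z
    using unif[of "{z}"] that by (auto simp: uniformly_convergent_on_def dest: tendsto_uniform_limitI)
  then obtain l where l: "\<And>z. z \<in> S \<Longrightarrow> (\<lambda>k. g k z) \<longlonglongrightarrow> l z" by metis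
  have ulim: "uniform_limit L g l sequentially" if L: "compact L" "L \<subseteq> S" for L
  proof -
    obtain l' where l': "uniform_limit L g l' sequentially"
      using unif[OF L] by (auto simp: uniformly_convergent_on_def)
    have "l' z = l z" if "z \<in> L" for z
      using LIMSEQ_unique[OF tendsto_uniform_limitI[OF l' that] l] L(2) that by blast
    with l' show ?thesis by (metis uniform_limit_cong')
  qed
  have "l holomorphic_on S"
  proof (rule holomorphic_uniform_sequence[OF \<open>open S\<close>])
    show "g n holomorphic_on S" for n using g(1) by (simp add: holo_space_def)
    show "\<exists>d>0. cball x d \<subseteq> S \<and> uniform_limit (cball x d) g l sequentially" if "x \<in> S" for x
      using ulim[OF compact_cball] open_contains_cball_eq[OF \<open>open S\<close>] that by meson
  qed
  then have l_in: "restrict l S \<in> holo_space S"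
    by (simp add: holo_space_def cong: holomorphic_cong)
  have "dist (l z) (g k z) \<le> e k" if "z \<in> K k" for z k
  proof (rule LIMSEQ_le_const2)
    have "z \<in> S" using g(2) that by blast
    then show "(\<lambda>j. dist (g j z) (g k z)) \<longlonglongrightarrow> dist (l z) (g k z)"
      by (intro tendsto_intros l)
    show "\<exists>N. \<forall>j\<ge>N. dist (g j z) (g k z) \<le> e k" using nested that by blast
  qed
  then have "restrict l S \<in> \<O> k \<inter> holo_nhd S (g k) (K k) (e k)" for k
    using g(2)[of "Suc k"] by (intro N_in l_in) (simp add: subset_iff)
  then have "restrict l S \<in> (\<Inter>k. \<O> k) \<inter> holo_nhd S (g 0) (K 0) (e 0)" by blast
  then show ?thesis using \<sigma>(2) by (auto simp: g_def K_def e_def)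
qed

lemma comeager_in_holo_INT:
  assumes "open S" "countable I" "I \<noteq> {}"
    and op: "\<And>i. i \<in> I \<Longrightarrow> openin (holo_topology S) (\<O> i)"
    and dense: "\<And>i g K e. i \<in> I \<Longrightarrow> g \<in> holo_space S \<Longrightarrow> compact K \<Longrightarrow> K \<subseteq> S \<Longrightarrow> 0 < e \<Longrightarrow>
        \<O> i \<inter> holo_nhd S g K e \<noteq> {}"
    and sub: "(\<Inter>i\<in>I. \<O> i) \<subseteq> \<B>" "\<B> \<subseteq> holo_space S"
  shows "comeager_in (holo_topology S) \<B>"
proof -
  define enum where "enum = from_nat_into I"
  have enum: "range enum = I"
    unfolding enum_def using assms(2,3) by (rule range_from_nat_into[rotated])
  have open_sub: "\<O> i \<subseteq> holo_space S" if "i \<in> I" for i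
    using openin_subset[OF op[OF that]] by simp
  have "(\<Inter>k. \<O> (enum k)) \<inter> holo_nhd S g K e \<noteq> {}"
    if "g \<in> holo_space S" "compact K" "K \<subseteq> S" "0 < e" for g K e
  proof (rule holo_Baire[OF \<open>open S\<close> _ _ that])
    fix k
    have k: "enum k \<in> I" using enum by blast
    show "openin (holo_topology S) (\<O> (enum k))" by (rule op[OF k])
    show "holo_topology S closure_of \<O> (enum k) = holo_space S"
      using dense[OF k] unfolding dense_holo_iff[OF open_sub[OF k]] by blast
  qed
  moreover have eq: "(\<Inter>k. \<O> (enum k)) = \<Inter>(\<O> ` I)"
    using enum by auto
  moreover have "\<Inter>(\<O> ` I) \<subseteq> holo_space S" using sub by blast
  ultimately have "holo_topology S closure_of \<Inter>(\<O> ` I) = holo_space S"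
    by (simp add: dense_holo_iff)
  moreover have "gdelta_in (holo_topology S) (\<Inter>(\<O> ` I))"
    using assms(2-3) op by (intro gdelta_in_Inter) (auto intro: open_imp_gdelta_in)
  ultimately show ?thesis
    using sub unfolding comeager_in_def by auto
qed

section \<open>Uniform approximation by algebras of functions\<close>

text \<open>The domain \<open>X\<close> has an arbitrary type, because approximation on two different sets at once (small
on a disc, close to a target on \<open>K\<close>) is treated below as approximation on a disjoint sum.\<close>

definition approximable :: "('a \<Rightarrow> complex) set \<Rightarrow> 'a set \<Rightarrow> ('a \<Rightarrow> complex) \<Rightarrow> bool"
  where "approximable S X v \<longleftrightarrow> (\<forall>e>0. \<exists>s\<in>S. \<forall>x\<in>X. norm (s x - v x) < e)"

lemma approximable_mem: "v \<in> S \<Longrightarrow> approximable S X v"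
  unfolding approximable_def by (auto intro!: bexI[of _ v])

lemma approximable_cong:
  assumes "\<And>x. x \<in> X \<Longrightarrow> v x = w x"
  shows "approximable S X v \<longleftrightarrow> approximable S X w"
  using assms by (simp add: approximable_def)

lemma approximable_limit:
  assumes "\<And>e. 0 < e \<Longrightarrow> \<exists>w. approximable S X w \<and> (\<forall>x\<in>X. norm (w x - v x) < e)"
  shows "approximable S X v"
  unfolding approximable_def
proof (intro allI impI)
  fix e :: real assume "0 < e"
  then obtain w where w: "approximable S X w" "\<forall>x\<in>X. norm (w x - v x) < e / 2"
    using assms[of "e / 2"] by auto
  then obtain s where "s \<in> S" "\<forall>x\<in>X. norm (s x - w x) < e / 2"
    using \<open>0 < e\<close> unfolding approximable_def by (meson half_gt_zero)
  with w(2) have "\<forall>x\<in>X. norm (s x - v x) < e" by (metis norm_diff_triangle_less field_sum_of_halves)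
  with \<open>s \<in> S\<close> show "\<exists>s\<in>S. \<forall>x\<in>X. norm (s x - v x) < e" by blast
qed

lemma approximable_add:
  assumes "\<And>s t. s \<in> S \<Longrightarrow> t \<in> S \<Longrightarrow> (\<lambda>x. s x + t x) \<in> S"
    and "approximable S X v" "approximable S X w"
  shows "approximable S X (\<lambda>x. v x + w x)"
  unfolding approximable_def
proof (intro allI impI)
  fix e :: real assume "0 < e"
  then have "0 < e / 2" by simp
  then obtain s t where st: "s \<in> S" "\<forall>x\<in>X. norm (s x - v x) < e / 2"
      "t \<in> S" "\<forall>x\<in>X. norm (t x - w x) < e / 2"
    using assms(2,3) unfolding approximable_def by meson
  have "norm (s x + t x - (v x + w x)) < e" if "x \<in> X" for x
  proof -
    have "norm (s x + t x - (v x + w x)) \<le> norm (s x - v x) + norm (t x - w x)"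
      by (rule norm_diff_triangle_ineq)
    with st that show ?thesis by fastforce
  qed
  with assms(1)[OF st(1,3)] show "\<exists>u\<in>S. \<forall>x\<in>X. norm (u x - (v x + w x)) < e"
    by (intro bexI[of _ "\<lambda>x. s x + t x"]) auto
qed

lemma approximable_mult:
  assumes "\<And>s t. s \<in> S \<Longrightarrow> t \<in> S \<Longrightarrow> (\<lambda>x. s x * t x) \<in> S"
    and "approximable S X v" "approximable S X w"
    and bdd: "bounded (v ` X)" "bounded (w ` X)"
  shows "approximable S X (\<lambda>x. v x * w x)"
  unfolding approximable_def
proof (intro allI impI)
  fix e :: real assume "0 < e"
  obtain c where c: "0 < c" "\<And>x. x \<in> X \<Longrightarrow> norm (v x) \<le> c"
    using bdd(1) by (auto simp: bounded_pos)
  obtain d where d: "0 < d" "\<And>x. x \<in> X \<Longrightarrow> norm (w x) \<le> d"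
    using bdd(2) by (auto simp: bounded_pos)
  define r where "r = min 1 (e / (c + d + 1))"
  have r: "0 < r" "r \<le> 1" using \<open>0 < e\<close> c(1) d(1) by (auto simp: r_def)
  have "r \<le> e / (c + d + 1)" by (simp add: r_def)
  then have re: "r * (c + d + 1) \<le> e" using c(1) d(1) by (simp add: pos_le_divide_eq)
  obtain s t where st: "s \<in> S" "\<forall>x\<in>X. norm (s x - v x) < r"
      "t \<in> S" "\<forall>x\<in>X. norm (t x - w x) < r"
    using assms(2,3) r(1) unfolding approximable_def by meson
  have "norm (s x * t x - v x * w x) < e" if "x \<in> X" for x
  proof -
    have lt: "norm (s x - v x) < r" "norm (t x - w x) < r" using st that by auto
    have "norm (t x) \<le> norm (t x - w x) + norm (w x)"
      by (metis diff_add_cancel norm_triangle_ineq)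
    then have t: "norm (t x) \<le> 1 + d" using lt(2) r(2) d(2)[OF that] by linarith
    have "s x * t x - v x * w x = (s x - v x) * t x + v x * (t x - w x)"
      by (simp add: algebra_simps)
    then have "norm (s x * t x - v x * w x) \<le> norm (s x - v x) * norm (t x) + norm (v x) * norm (t x - w x)"
      by (metis norm_mult norm_triangle_ineq)
    also have "\<dots> \<le> norm (s x - v x) * (1 + d) + c * norm (t x - w x)"
      by (intro add_mono mult_mono t c that) (use c d in auto)
    also have "\<dots> < r * (1 + d) + c * r"
      using lt c(1) d(1) by (intro add_strict_mono mult_strict_right_mono mult_strict_left_mono) auto
    also have "\<dots> \<le> e" using re by (simp add: algebra_simps)
    finally show ?thesis .
  qed
  with assms(1)[OF st(1,3)] show "\<exists>u\<in>S. \<forall>x\<in>X. norm (u x - v x * w x) < e"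
    by (intro bexI[of _ "\<lambda>x. s x * t x"]) auto
qed

text \<open>The Stone-Weierstrass theorem on \<open>K\<close>, transported to \<open>X\<close>. The function \<open>\<gamma>\<close> is the characteristic
function of a part of \<open>X\<close> that \<open>\<pi>\<close> maps into \<open>K\<close>; on the rest the targets vanish. Since
\<open>\<gamma> * \<gamma> = \<gamma>\<close>, the functions \<open>u\<close> on \<open>K\<close> for which \<open>\<gamma> * (u \<circ> \<pi>)\<close> is approximable form a closed algebra,
and it suffices that this algebra contains the constants and the two coordinates.\<close>

lemma approximable_pullback:
  fixes \<gamma> \<pi> :: "'a \<Rightarrow> complex"
  assumes add: "\<And>s t. s \<in> S \<Longrightarrow> t \<in> S \<Longrightarrow> (\<lambda>x. s x + t x) \<in> S"
    and mult: "\<And>s t. s \<in> S \<Longrightarrow> t \<in> S \<Longrightarrow> (\<lambda>x. s x * t x) \<in> S"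
    and "compact K" and \<gamma>: "\<And>x. x \<in> X \<Longrightarrow> \<gamma> x = 0 \<or> \<gamma> x = 1 \<and> \<pi> x \<in> K"
    and const: "\<And>c. approximable S X (\<lambda>x. \<gamma> x * c)"
    and Re: "approximable S X (\<lambda>x. \<gamma> x * of_real (Re (\<pi> x)))"
    and Im: "approximable S X (\<lambda>x. \<gamma> x * of_real (Im (\<pi> x)))"
    and u: "continuous_on K u"
  shows "approximable S X (\<lambda>x. \<gamma> x * u (\<pi> x))"
proof -
  have bdd: "bounded ((\<lambda>x. \<gamma> x * v (\<pi> x)) ` X)" if "continuous_on K v" for v
  proof -
    have "bounded (insert 0 (v ` K))"
      using compact_imp_bounded[OF compact_continuous_image[OF that \<open>compact K\<close>]] by simp
    moreover have "(\<lambda>x. \<gamma> x * v (\<pi> x)) ` X \<subseteq> insert 0 (v ` K)" using \<gamma> by fastforce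
    ultimately show ?thesis by (rule bounded_subset)
  qed
  have prod: "approximable S X (\<lambda>x. \<gamma> x * (v (\<pi> x) * w (\<pi> x)))"
    if "continuous_on K v" "continuous_on K w"
      "approximable S X (\<lambda>x. \<gamma> x * v (\<pi> x))" "approximable S X (\<lambda>x. \<gamma> x * w (\<pi> x))" for v w
  proof -
    have "approximable S X (\<lambda>x. (\<gamma> x * v (\<pi> x)) * (\<gamma> x * w (\<pi> x)))"
      using mult that(3,4) bdd[OF that(1)] bdd[OF that(2)] by (rule approximable_mult)
    moreover have "(\<gamma> x * v (\<pi> x)) * (\<gamma> x * w (\<pi> x)) = \<gamma> x * (v (\<pi> x) * w (\<pi> x))"
      if "x \<in> X" for x
      using \<gamma>[OF that] by auto
    ultimately show ?thesis by (simp cong: approximable_cong)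
  qed
  have real: "approximable S X (\<lambda>x. \<gamma> x * of_real (q (\<pi> x)))"
    if q: "continuous_on K q" for q :: "complex \<Rightarrow> real"
  proof (rule approximable_limit)
    fix e :: real assume "0 < e"
    define P where "P q \<longleftrightarrow> continuous_on K q \<and> approximable S X (\<lambda>x. \<gamma> x * of_real (q (\<pi> x)))"
      for q :: "complex \<Rightarrow> real"
    have "\<exists>g. P g \<and> (\<forall>z\<in>K. \<bar>q z - g z\<bar> < e)"
    proof (rule Stone_Weierstrass_HOL[OF \<open>compact K\<close>])
      fix f g :: "complex \<Rightarrow> real" assume "P f \<and> P g"
      then have f: "continuous_on K f" "approximable S X (\<lambda>x. \<gamma> x * of_real (f (\<pi> x)))"
        and g: "continuous_on K g" "approximable S X (\<lambda>x. \<gamma> x * of_real (g (\<pi> x)))"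
        by (auto simp: P_def)
      have "approximable S X (\<lambda>x. \<gamma> x * of_real (f (\<pi> x)) + \<gamma> x * of_real (g (\<pi> x)))"
        by (rule approximable_add[OF add f(2) g(2)])
      then show "P (\<lambda>z. f z + g z)"
        using f g by (auto simp: P_def distrib_left intro!: continuous_intros)
      have "approximable S X (\<lambda>x. \<gamma> x * (of_real (f (\<pi> x)) * of_real (g (\<pi> x))))"
        using f g by (intro prod[of "\<lambda>z. of_real (f z)" "\<lambda>z. of_real (g z)"] continuous_intros)
      then show "P (\<lambda>z. f z * g z)"
        using f g by (auto simp: P_def intro!: continuous_intros)
    next
      fix x y :: complex assume "x \<in> K \<and> y \<in> K \<and> x \<noteq> y"
      moreover have "P Re" "P Im" using Re Im by (auto simp: P_def intro!: continuous_intros)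
      ultimately show "\<exists>f. P f \<and> f x \<noteq> f y" by (metis complex_eqI)
    qed (use const q \<open>0 < e\<close> in \<open>auto simp: P_def\<close>)
    then obtain g where g: "P g" "\<forall>z\<in>K. \<bar>q z - g z\<bar> < e" by blast
    have "norm (\<gamma> x * of_real (g (\<pi> x)) - \<gamma> x * of_real (q (\<pi> x))) < e" if "x \<in> X" for x
      using \<gamma>[OF that] g(2) \<open>0 < e\<close>
      by (auto simp: abs_minus_commute simp flip: of_real_diff)
    with g(1) show "\<exists>w. approximable S X w \<and> (\<forall>x\<in>X. norm (w x - \<gamma> x * of_real (q (\<pi> x))) < e)"
      unfolding P_def by blast
  qed
  have "approximable S X (\<lambda>x. \<gamma> x * (\<i> * of_real (Im (u (\<pi> x)))))"
    using u by (intro prod[of "\<lambda>_. \<i>" "\<lambda>z. of_real (Im (u z))"] const real continuous_intros)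
  then have "approximable S X (\<lambda>x. \<gamma> x * of_real (Re (u (\<pi> x))) + \<gamma> x * (\<i> * of_real (Im (u (\<pi> x)))))"
    using u by (intro approximable_add[OF add] real continuous_intros)
  moreover have "\<gamma> x * of_real (Re (u (\<pi> x))) + \<gamma> x * (\<i> * of_real (Im (u (\<pi> x)))) = \<gamma> x * u (\<pi> x)" for x
    using complex_eq[of "u (\<pi> x)"] by (metis distrib_left)
  ultimately show ?thesis by simp
qed

lemma countable_closed_under_operations:
  fixes A :: "'a set"
  assumes "countable A"
  obtains S where "countable S" "A \<subseteq> S" "\<And>x y. x \<in> S \<Longrightarrow> y \<in> S \<Longrightarrow> f x y \<in> S"
    "\<And>x y. x \<in> S \<Longrightarrow> y \<in> S \<Longrightarrow> g x y \<in> S"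
proof -
  define F where "F T = T \<union> case_prod f ` (T \<times> T) \<union> case_prod g ` (T \<times> T)" for T
  define S where "S = (\<Union>n. (F ^^ n) A)"
  have "countable ((F ^^ n) A)" for n
    by (induction n) (use assms in \<open>auto simp: F_def\<close>)
  then have "countable S" by (simp add: S_def)
  moreover have "A \<subseteq> S" unfolding S_def using UN_upper[of 0 UNIV "\<lambda>n. (F ^^ n) A"] by simp
  moreover have "f x y \<in> S \<and> g x y \<in> S" if "x \<in> S" "y \<in> S" for x y
  proof -
    have mono: "(F ^^ m) A \<subseteq> (F ^^ n) A" if "m \<le> n" for m n
      by (rule lift_Suc_mono_le[OF _ that]) (auto simp: F_def)
    obtain m n where "x \<in> (F ^^ m) A" "y \<in> (F ^^ n) A" using \<open>x \<in> S\<close> \<open>y \<in> S\<close> by (auto simp: S_def)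
    then have "x \<in> (F ^^ max m n) A" "y \<in> (F ^^ max m n) A"
      using mono[of m "max m n"] mono[of n "max m n"] by auto
    then have "f x y \<in> (F ^^ Suc (max m n)) A" "g x y \<in> (F ^^ Suc (max m n)) A"
      by (force simp: F_def)+
    then show ?thesis unfolding S_def by blast
  qed
  ultimately show thesis using that by blast
qed

text \<open>One countable family serves all compact sets \<open>K\<close>: a countable set that is closed under sums and
products and contains \<open>Re\<close>, \<open>Im\<close> and the Gaussian rational constants.\<close>

lemma countable_dense_continuous:
  obtains D :: "(complex \<Rightarrow> complex) set"
  where "countable D" "D \<noteq> {}"
    "\<And>d. d \<in> D \<Longrightarrow> continuous_on UNIV d"
    "\<And>K u. compact K \<Longrightarrow> continuous_on K u \<Longrightarrow> approximable D K u"
proof -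
  define A :: "(complex \<Rightarrow> complex) set" where
    "A = {(\<lambda>z. of_real (Re z)), (\<lambda>z. of_real (Im z))} \<union>
       (\<lambda>(a, b) _. Complex (of_rat a) (of_rat b)) ` UNIV"
  have "countable A" by (simp add: A_def)
  then obtain S where S: "countable S" "A \<subseteq> S" "\<And>v w. v \<in> S \<Longrightarrow> w \<in> S \<Longrightarrow> (\<lambda>z. v z + w z) \<in> S"
    "\<And>v w. v \<in> S \<Longrightarrow> w \<in> S \<Longrightarrow> (\<lambda>z. v z * w z) \<in> S"
    using countable_closed_under_operations[of A "\<lambda>v w z. v z + w z" "\<lambda>v w z. v z * w z"] by blast
  \<comment> \<open>Nothing but the closure properties is known of \<open>S\<close>; continuity is preserved by both operations.\<close>
  define D where "D = {d \<in> S. continuous_on UNIV d}"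
  have A_D: "A \<subseteq> D"
    using S(2) by (auto simp: D_def A_def intro!: continuous_intros)
  have D_add: "(\<lambda>z. v z + w z) \<in> D" and D_mult: "(\<lambda>z. v z * w z) \<in> D" if "v \<in> D" "w \<in> D" for v w
    using that S(3,4) by (auto simp: D_def intro!: continuous_intros)
  have "approximable D K u" if "compact K" "continuous_on K u" for K u
  proof -
    have const: "approximable D K (\<lambda>_. c)" for c
      unfolding approximable_def
    proof (intro allI impI)
      fix e :: real assume "0 < e"
      have "\<exists>q. \<bar>of_rat q - x\<bar> < e / 2" for x
      proof -
        obtain q where "x - e / 2 < of_rat q" "of_rat q < x + e / 2"
          using of_rat_dense[of "x - e / 2" "x + e / 2"] \<open>0 < e\<close> by auto
        then have "\<bar>of_rat q - x\<bar> < e / 2" unfolding abs_less_iff by linarith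
        then show ?thesis ..
      qed
      then obtain a b where ab: "\<bar>of_rat a - Re c\<bar> < e / 2" "\<bar>of_rat b - Im c\<bar> < e / 2" by metis
      let ?c = "Complex (of_rat a) (of_rat b)"
      have "norm (?c - c) \<le> \<bar>Re (?c - c)\<bar> + \<bar>Im (?c - c)\<bar>" by (rule cmod_le)
      with ab have "norm (?c - c) < e" by simp
      moreover have "(\<lambda>_. ?c) \<in> D" using A_D by (auto simp: A_def)
      ultimately show "\<exists>s\<in>D. \<forall>x\<in>K. norm (s x - c) < e"
        by (intro bexI[of _ "\<lambda>_. ?c"]) auto
    qed
    have "approximable D K (\<lambda>z. 1 * u z)"
      by (rule approximable_pullback[where \<pi> = "\<lambda>z. z", OF D_add D_mult that(1)])
        (use const that A_D in \<open>auto simp: A_def intro!: approximable_mem\<close>)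
    then show ?thesis by simp
  qed
  with S(1) A_D show thesis by (intro that[of D]) (auto simp: D_def A_def)
qed

section \<open>Interpolation by entire functions that are small on a disc\<close>

text \<open>The nodes lie outside the disc of radius \<open>R\<close>. A new node \<open>x\<close> is served by adding a multiple of
\<open>(\<zeta> / x) ^ m\<close> times a polynomial that vanishes at the earlier nodes: the power is \<open>1\<close> at \<open>x\<close> and tends
to \<open>0\<close> uniformly on the disc as \<open>m\<close> grows.\<close>

lemma interpolation_small_on_disc:
  assumes "finite X" "0 \<le> R" "\<And>x. x \<in> X \<Longrightarrow> R < norm x" "0 < e"
  shows "\<exists>P. P holomorphic_on UNIV \<and> (\<forall>x\<in>X. P x = c x) \<and> (\<forall>\<zeta>\<in>cball 0 R. norm (P \<zeta>) < e)"
  using assms(1,3,4)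
proof (induction X arbitrary: e rule: finite_induct)
  case empty
  then show ?case by (intro exI[of _ "\<lambda>_. 0"]) auto
next
  case (insert x X)
  from insert obtain P where P: "P holomorphic_on UNIV" "\<forall>x\<in>X. P x = c x"
      "\<forall>\<zeta>\<in>cball 0 R. norm (P \<zeta>) < e / 2"
    by (metis half_gt_zero insertI2)
  have x: "R < norm x" "x \<noteq> 0" using insert.prems \<open>0 \<le> R\<close> by force+
  define Q where "Q \<zeta> = (c x - P x) * (\<Prod>y\<in>X. (\<zeta> - y) / (x - y))" for \<zeta>
  have Q: "Q holomorphic_on UNIV" unfolding Q_def
    using insert.hyps(2) by (intro holomorphic_intros) auto
  have "bounded (Q ` cball 0 R)"
    by (intro compact_imp_bounded compact_continuous_image holomorphic_on_imp_continuous_on holomorphic_on_subset[OF Q]) auto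
  then obtain b where b: "0 < b" "\<And>\<zeta>. \<zeta> \<in> cball 0 R \<Longrightarrow> norm (Q \<zeta>) \<le> b"
    by (auto simp: bounded_pos)
  have "(\<lambda>m. (R / norm x) ^ m) \<longlonglongrightarrow> 0"
    using x \<open>0 \<le> R\<close> by (intro LIMSEQ_realpow_zero) auto
  then have "\<forall>\<^sub>F m in sequentially. (R / norm x) ^ m < e / (2 * b)"
    using b(1) insert.prems by (intro order_tendstoD) auto
  then obtain m where m: "(R / norm x) ^ m < e / (2 * b)"
    by (auto simp: eventually_sequentially)
  show ?case
  proof (intro exI[of _ "\<lambda>\<zeta>. P \<zeta> + (\<zeta> / x) ^ m * Q \<zeta>"] conjI ballI)
    show "(\<lambda>\<zeta>. P \<zeta> + (\<zeta> / x) ^ m * Q \<zeta>) holomorphic_on UNIV"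
      by (intro holomorphic_intros P Q) (use x in auto)
  next
    fix y assume y: "y \<in> insert x X"
    show "P y + (y / x) ^ m * Q y = c y"
    proof (cases "y = x")
      case True
      have "Q x = c x - P x" using insert.hyps by (auto simp: Q_def intro!: prod.neutral)
      with True x show ?thesis by simp
    next
      case False
      then have "Q y = 0" using y insert.hyps by (auto simp: Q_def)
      with False y P show ?thesis by simp
    qed
  next
    fix \<zeta> :: complex assume \<zeta>: "\<zeta> \<in> cball 0 R"
    have "norm ((\<zeta> / x) ^ m * Q \<zeta>) \<le> (R / norm x) ^ m * b"
      using \<zeta> b x \<open>0 \<le> R\<close>
      by (auto simp: norm_mult norm_power norm_divide intro!: mult_mono power_mono divide_right_mono)
    also have "\<dots> < e / 2" using m b(1) by (simp add: field_simps)
    finally have "norm ((\<zeta> / x) ^ m * Q \<zeta>) < e / 2" .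
    moreover have "norm (P \<zeta>) < e / 2" using P(3) \<zeta> by blast
    ultimately show "norm (P \<zeta> + (\<zeta> / x) ^ m * Q \<zeta>) < e"
      using norm_triangle_ineq[of "P \<zeta>" "(\<zeta> / x) ^ m * Q \<zeta>"] by linarith
  qed
qed

section \<open>Generic compact sets\<close>

text \<open>A function that is holomorphic off \<open>a\<close> can be corrected by \<open>P (1 / (w - a))\<close>: on the set
\<open>norm (1 / (w - a)) \<le> R\<close> it changes by less than \<open>e\<close>, while its composition with \<open>h\<close> changes on \<open>K\<close> by
\<open>u\<close> up to \<open>e\<close>. In the application \<open>h\<close> is an iterate of \<open>f\<close>.\<close>

definition correctable :: "(complex \<Rightarrow> complex) \<Rightarrow> complex \<Rightarrow> real \<Rightarrow> complex set \<Rightarrow> (complex \<Rightarrow> complex) \<Rightarrow> real \<Rightarrow> bool"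
  where "correctable h a R K u e \<longleftrightarrow> (\<exists>P. P holomorphic_on UNIV \<and> (\<forall>\<zeta>\<in>cball 0 R. norm (P \<zeta>) < e) \<and>
    (\<forall>z\<in>K. h z \<noteq> a \<and> norm (P (1 / (h z - a)) - u z) < e))"

lemma correctable_mono: "correctable h a R K u e \<Longrightarrow> e \<le> e' \<Longrightarrow> correctable h a R K u e'"
  unfolding correctable_def by (meson less_le_trans)

text \<open>For a fixed \<open>P\<close> the condition says that \<open>K\<close> is contained in an open set.\<close>

lemma openin_correctable:
  assumes "open U" "B \<subseteq> U" "continuous_on U h" "continuous_on U u"
  shows "openin (compacts_topology B) {K \<in> nonempty_compacts B. correctable h a R K u e}"
proof -
  define \<P> where "\<P> = {P. P holomorphic_on UNIV \<and> (\<forall>\<zeta>\<in>cball 0 R. norm (P \<zeta>) < e)}"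
  define U' where "U' = U \<inter> h -` (- {a})"
  define G where "G P = U' \<inter> (\<lambda>z. norm (P (1 / (h z - a)) - u z)) -` {..<e}" for P
  have U': "open U'" unfolding U'_def
    by (intro continuous_open_preimage assms(1,3)) auto
  have cont: "continuous_on U' h" "continuous_on U' u"
    using assms(3,4) by (auto simp: U'_def intro: continuous_on_subset)
  have "open (G P)" if "P \<in> \<P>" for P
  proof -
    have "continuous_on UNIV P" using that by (simp add: \<P>_def holomorphic_on_imp_continuous_on)
    moreover have "continuous_on U' (\<lambda>z. 1 / (h z - a))"
      by (intro continuous_intros cont) (simp add: U'_def)
    ultimately have "continuous_on U' (\<lambda>z. P (1 / (h z - a)))"
      by (rule continuous_on_compose2) simp
    then have "continuous_on U' (\<lambda>z. norm (P (1 / (h z - a)) - u z))"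
      by (intro continuous_intros cont)
    then show ?thesis unfolding G_def by (intro continuous_open_preimage U') auto
  qed
  then have "openin (compacts_topology B) (\<Union>P\<in>\<P>. {K \<in> nonempty_compacts B. K \<subseteq> G P})"
    by (intro openin_Union) (auto intro: openin_compacts_subset)
  moreover have "{K \<in> nonempty_compacts B. correctable h a R K u e} = (\<Union>P\<in>\<P>. {K \<in> nonempty_compacts B. K \<subseteq> G P})"
  proof (intro equalityI subsetI)
    fix K assume "K \<in> {K \<in> nonempty_compacts B. correctable h a R K u e}"
    then obtain P where P: "K \<in> nonempty_compacts B" "P \<in> \<P>"
        "\<forall>z\<in>K. h z \<noteq> a \<and> norm (P (1 / (h z - a)) - u z) < e"
      unfolding correctable_def \<P>_def by blast
    then have "K \<subseteq> G P"
      using assms(2) unfolding G_def U'_def nonempty_compacts_def by blast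
    with P(1,2) show "K \<in> (\<Union>P\<in>\<P>. {K \<in> nonempty_compacts B. K \<subseteq> G P})" by blast
  next
    fix K assume "K \<in> (\<Union>P\<in>\<P>. {K \<in> nonempty_compacts B. K \<subseteq> G P})"
    then obtain P where P: "P \<in> \<P>" "K \<in> nonempty_compacts B" "K \<subseteq> G P" by blast
    then have "\<forall>z\<in>K. h z \<noteq> a \<and> norm (P (1 / (h z - a)) - u z) < e"
      by (auto simp: G_def U'_def)
    with P(1,2) show "K \<in> {K \<in> nonempty_compacts B. correctable h a R K u e}"
      unfolding correctable_def \<P>_def by blast
  qed
  ultimately show ?thesis by simp
qed

lemma correctable_finite:
  assumes "finite F" "inj_on h F" "a \<notin> h ` F" "0 \<le> R" "0 < e"
    and near: "\<And>z. z \<in> F \<Longrightarrow> dist (h z) a * R < 1"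
  shows "correctable h a R F u e"
proof -
  define \<zeta> where "\<zeta> z = 1 / (h z - a)" for z
  have ne: "h z \<noteq> a" if "z \<in> F" for z using assms(3) that by blast
  have inj: "inj_on \<zeta> F"
    using assms(2) ne by (auto simp: inj_on_def \<zeta>_def)
  have "R < norm x" if "x \<in> \<zeta> ` F" for x
    using that near ne by (auto simp: \<zeta>_def norm_divide dist_norm field_simps)
  then obtain P where P: "P holomorphic_on UNIV" "\<forall>x\<in>\<zeta> ` F. P x = u (inv_into F \<zeta> x)"
      "\<forall>\<zeta>\<in>cball 0 R. norm (P \<zeta>) < e"
    using interpolation_small_on_disc[of "\<zeta> ` F" R e "\<lambda>x. u (inv_into F \<zeta> x)"] assms(1,4,5) by auto
  have "P (1 / (h z - a)) = u z" if "z \<in> F" for z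
    using P(2) that inj by (simp add: \<zeta>_def[symmetric])
  with P ne \<open>0 < e\<close> show ?thesis unfolding correctable_def by auto
qed

lemma dense_correctable:
  fixes B :: "complex set"
  assumes K: "K \<in> nonempty_compacts B" and "0 < r" "0 \<le> R" "0 < e"
    and "\<And>x. x \<in> B \<Longrightarrow> x islimpt B" "\<And>y. finite {x \<in> B. h x = y}"
    and near: "\<And>z. z \<in> B \<Longrightarrow> dist (h z) a * R < 1"
  shows "\<exists>L\<in>{L \<in> nonempty_compacts B. correctable h a R L u e}. hausdorff_dist K L < r"
proof -
  obtain F where F: "finite F" "F \<noteq> {}" "F \<subseteq> B" "inj_on h F" "a \<notin> h ` F" "hausdorff_dist K F < r"
    using finite_approximation_injective[of K B r h a] assms by (auto simp: nonempty_compacts_def)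
  then have "F \<in> nonempty_compacts B" by (auto simp: nonempty_compacts_def finite_imp_compact)
  moreover have "correctable h a R F u e" using F assms by (intro correctable_finite) auto
  ultimately show ?thesis using F(6) by blast
qed

text \<open>Smallness on the disc and closeness to \<open>u\<close> on \<open>K\<close> are together approximation of the function
that is \<open>0\<close> on the disc and \<open>u\<close> on \<open>K\<close>, on the disjoint sum of the two sets. The approximating
functions, one for each entire \<open>P\<close>, are closed under sums and products, so the Stone-Weierstrass
argument applies.\<close>

lemma correctable_continuous:
  assumes "compact K" and u: "continuous_on K u" and "0 < e"
    and corr: "\<And>v e. v \<in> {\<lambda>_. 1, \<lambda>z. of_real (Re z), \<lambda>z. of_real (Im z)} \<Longrightarrow> 0 < e \<Longrightarrow> correctable h a R K v e"
  shows "correctable h a R K u e"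
proof -
  define S where "S = (\<lambda>P. case_sum P (\<lambda>z. P (1 / (h z - a)))) ` {P. P holomorphic_on UNIV}"
  define X where "X = cball (0::complex) R <+> K"
  define \<gamma> where "\<gamma> = case_sum (\<lambda>_::complex. 0) (\<lambda>_::complex. 1::complex)"
  define \<pi> where "\<pi> = case_sum (\<lambda>_::complex. 0) (\<lambda>z::complex. z)"
  have iff: "approximable S X (\<lambda>x. \<gamma> x * v (\<pi> x)) \<longleftrightarrow> (\<forall>e>0. \<exists>P. P holomorphic_on UNIV \<and>
      (\<forall>\<zeta>\<in>cball 0 R. norm (P \<zeta>) < e) \<and> (\<forall>z\<in>K. norm (P (1 / (h z - a)) - v z) < e))" for v
    by (auto simp: approximable_def S_def X_def \<gamma>_def \<pi>_def Plus_def ball_Un)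
  have basic: "approximable S X (\<lambda>x. \<gamma> x * v (\<pi> x))"
    if "v \<in> {\<lambda>_. 1, \<lambda>z. of_real (Re z), \<lambda>z. of_real (Im z)}" for v
    unfolding iff using corr[OF that] unfolding correctable_def by blast
  have S_add: "(\<lambda>x. s x + t x) \<in> S" and S_mult: "(\<lambda>x. s x * t x) \<in> S" if st: "s \<in> S" "t \<in> S" for s t
  proof -
    obtain P Q where PQ: "P holomorphic_on UNIV" "s = case_sum P (\<lambda>z. P (1 / (h z - a)))"
        "Q holomorphic_on UNIV" "t = case_sum Q (\<lambda>z. Q (1 / (h z - a)))"
      using st by (auto simp: S_def)
    have "(\<lambda>x. s x + t x) = case_sum (\<lambda>\<zeta>. P \<zeta> + Q \<zeta>) (\<lambda>z. P (1 / (h z - a)) + Q (1 / (h z - a)))"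
      by (auto simp: PQ fun_eq_iff split: sum.split)
    then show "(\<lambda>x. s x + t x) \<in> S"
      using PQ unfolding S_def by (intro image_eqI[of _ _ "\<lambda>\<zeta>. P \<zeta> + Q \<zeta>"]) (auto intro!: holomorphic_intros)
    have "(\<lambda>x. s x * t x) = case_sum (\<lambda>\<zeta>. P \<zeta> * Q \<zeta>) (\<lambda>z. P (1 / (h z - a)) * Q (1 / (h z - a)))"
      by (auto simp: PQ fun_eq_iff split: sum.split)
    then show "(\<lambda>x. s x * t x) \<in> S"
      using PQ unfolding S_def by (intro image_eqI[of _ _ "\<lambda>\<zeta>. P \<zeta> * Q \<zeta>"]) (auto intro!: holomorphic_intros)
  qed
  have "approximable S X (\<lambda>x. \<gamma> x * c)" for c
  proof (rule approximable_mult[OF S_mult])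
    show "approximable S X \<gamma>" using basic[of "\<lambda>_. 1"] by simp
    show "approximable S X (\<lambda>_. c)"
      by (rule approximable_mem) (auto simp: S_def fun_eq_iff split: sum.split intro!: image_eqI[of _ _ "\<lambda>_. c"])
    have "\<gamma> ` X \<subseteq> {0, 1}" by (auto simp: \<gamma>_def split: sum.split)
    then show "bounded (\<gamma> ` X)" by (rule bounded_subset[rotated]) simp
    have "(\<lambda>_::complex + complex. c) ` X \<subseteq> {c}" by auto
    then show "bounded ((\<lambda>_. c) ` X)" by (rule bounded_subset[rotated]) simp
  qed
  moreover have "approximable S X (\<lambda>x. \<gamma> x * of_real (Re (\<pi> x)))" by (rule basic) simp
  moreover have "approximable S X (\<lambda>x. \<gamma> x * of_real (Im (\<pi> x)))" by (rule basic) simp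
  moreover have "\<gamma> x = 0 \<or> \<gamma> x = 1 \<and> \<pi> x \<in> K" if "x \<in> X" for x
    using that by (auto simp: X_def \<gamma>_def \<pi>_def)
  ultimately have "approximable S X (\<lambda>x. \<gamma> x * u (\<pi> x))"
    using approximable_pullback[OF S_add S_mult \<open>compact K\<close>] u by blast
  moreover have "h z \<noteq> a" if "z \<in> K" for z
    using corr[of "\<lambda>_. 1" 1] that unfolding correctable_def by auto
  ultimately show ?thesis using \<open>0 < e\<close> unfolding iff correctable_def by meson
qed

text \<open>Countably many open dense conditions: each involves an index \<open>n\<close>, an integral radius \<open>R\<close> such
that \<open>1 / (h n z - a)\<close> is outside the disc for all \<open>z \<in> B\<close> with \<open>h n z \<noteq> a\<close>, one of three target functions and a precision. The radius \<open>0\<close> is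
always admissible; this makes the index set non-empty and forces every \<open>h n\<close> to avoid \<open>a\<close> on \<open>K\<close>.\<close>

lemma comeager_in_correctable:
  fixes B U :: "complex set" and h :: "nat \<Rightarrow> complex \<Rightarrow> complex"
  assumes "compact B" and perfect: "\<And>x. x \<in> B \<Longrightarrow> x islimpt B" and U: "open U" "B \<subseteq> U"
    and h: "\<And>n. continuous_on U (h n)" "\<And>n y. finite {x \<in> B. h n x = y}"
  shows "comeager_in (compacts_topology B) {K \<in> nonempty_compacts B.
    \<forall>n R u e. (\<forall>z\<in>B. dist (h n z) a * real R < 1) \<longrightarrow> continuous_on K u \<longrightarrow> 0 < e \<longrightarrow> correctable (h n) a R K u e}"
proof -
  define V where "V = {\<lambda>_::complex. 1, \<lambda>z. of_real (Re z), \<lambda>z. complex_of_real (Im z)}"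
  define I where "I = {(n, R::nat). \<forall>z\<in>B. dist (h n z) a * real R < 1} \<times> V \<times> (UNIV :: nat set)"
  define \<A> where "\<A> = (\<lambda>((n, R), v, m). {K \<in> nonempty_compacts B. correctable (h n) a (real R) K v (1 / Suc m)})"
  show ?thesis
  proof (rule comeager_in_compacts_INT[OF \<open>compact B\<close>])
    show "countable I" by (auto simp: I_def V_def)
    have "((0, 0), (\<lambda>_. 1), 0) \<in> I" by (simp add: I_def V_def)
    then show "I \<noteq> {}" by blast
    fix i assume "i \<in> I"
    then obtain n R v m where i: "i = ((n, R), v, m)" "\<And>z. z \<in> B \<Longrightarrow> dist (h n z) a * real R < 1" "v \<in> V"
      by (auto simp: I_def)
    have "continuous_on U v" using i(3) by (auto simp: V_def intro!: continuous_intros)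
    then show "openin (compacts_topology B) (\<A> i)"
      by (simp add: \<A>_def i openin_correctable[OF U h(1)])
    fix K r assume "K \<in> nonempty_compacts B" "(0::real) < r"
    then show "\<exists>L\<in>\<A> i. hausdorff_dist K L < r"
      using dense_correctable[of K B r "real R" "1 / Suc m" "h n" a v] perfect h(2) i(2)
      by (simp add: \<A>_def i(1))
  next
    show "(\<Inter>i\<in>I. \<A> i) \<subseteq> {K \<in> nonempty_compacts B.
      \<forall>n R u e. (\<forall>z\<in>B. dist (h n z) a * real R < 1) \<longrightarrow> continuous_on K u \<longrightarrow> 0 < e \<longrightarrow> correctable (h n) a R K u e}"
    proof (intro subsetI CollectI conjI allI impI)
      fix K assume K: "K \<in> (\<Inter>i\<in>I. \<A> i)"
      then have "K \<in> \<A> ((0, 0), (\<lambda>_. 1), 0)" by (rule INT_D) (simp add: I_def V_def)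
      then show "K \<in> nonempty_compacts B" by (simp add: \<A>_def)
      then have "compact K" by (simp add: nonempty_compacts_def)
      fix n R and u :: "complex \<Rightarrow> complex" and e :: real
      assume nR: "\<forall>z\<in>B. dist (h n z) a * real R < 1" and u: "continuous_on K u" "0 < e"
      show "correctable (h n) a R K u e"
      proof (rule correctable_continuous[OF \<open>compact K\<close> u])
        fix v :: "complex \<Rightarrow> complex" and e :: real
        assume v: "v \<in> {\<lambda>_. 1, \<lambda>z. of_real (Re z), \<lambda>z. of_real (Im z)}" and "0 < e"
        then obtain m where m: "1 / Suc m < e" by (meson nat_approx_posE)
        have "K \<in> \<A> ((n, R), v, m)" using K by (rule INT_D) (use nR v in \<open>simp add: I_def V_def\<close>)
        then have "correctable (h n) a (real R) K v (1 / Suc m)" by (simp add: \<A>_def)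
        then show "correctable (h n) a (real R) K v e" using m by (rule correctable_mono[OF _ less_imp_le])
      qed
    qed
  qed auto
qed

section \<open>Universal functions for a generic compact set\<close>

lemma openin_approximating_composition:
  assumes "compact K" "continuous_on K h" "h ` K \<subseteq> S" "continuous_on K u"
  shows "openin (holo_topology S) {g \<in> holo_space S. \<forall>z\<in>K. norm (g (h z) - u z) < e}"
  unfolding openin_holo_topology
proof (intro conjI ballI)
  fix g assume g: "g \<in> {g \<in> holo_space S. \<forall>z\<in>K. norm (g (h z) - u z) < e}"
  then have "g holomorphic_on S" by (simp add: holo_space_def)
  then have "continuous_on K (\<lambda>z. g (h z))"
    using assms(2,3) by (rule continuous_on_compose2[OF holomorphic_on_imp_continuous_on])
  then have cont: "continuous_on K (\<lambda>z. norm (g (h z) - u z))"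
    by (intro continuous_intros assms(4))
  have "\<exists>r>0. \<forall>z\<in>K. norm (g (h z) - u z) \<le> e - r"
  proof (cases "K = {}")
    case False
    then obtain w where w: "w \<in> K" "\<forall>z\<in>K. norm (g (h z) - u z) \<le> norm (g (h w) - u w)"
      using continuous_attains_sup[OF assms(1) False cont] by blast
    then show ?thesis using g by (intro exI[of _ "e - norm (g (h w) - u w)"]) simp
  qed (auto intro: exI[of _ 1])
  then obtain r where r: "0 < r" "\<And>z. z \<in> K \<Longrightarrow> norm (g (h z) - u z) \<le> e - r" by blast
  have "holo_nhd S g (h ` K) r \<subseteq> {g \<in> holo_space S. \<forall>z\<in>K. norm (g (h z) - u z) < e}"
  proof (intro subsetI CollectI conjI ballI)
    fix k z assume k: "k \<in> holo_nhd S g (h ` K) r" and "z \<in> K"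
    then have "norm (k (h z) - g (h z)) < r" by (simp add: holo_nhd_def dist_norm)
    with r(2)[OF \<open>z \<in> K\<close>] show "norm (k (h z) - u z) < e"
      using norm_triangle_ineq[of "k (h z) - g (h z)" "g (h z) - u z"] by simp
  qed (simp add: holo_nhd_def)
  with r(1) assms(1-3) show "\<exists>L r. compact L \<and> L \<subseteq> S \<and> 0 < r \<and>
      holo_nhd S g L r \<subseteq> {g \<in> holo_space S. \<forall>z\<in>K. norm (g (h z) - u z) < e}"
    by (intro exI[of _ "h ` K"] exI[of _ r] conjI) (simp_all add: compact_continuous_image)
qed auto

text \<open>The correction is applied with target \<open>u - g0 \<circ> h\<close>.\<close>

lemma dense_approximating_composition:
  assumes g0: "g0 \<in> holo_space (- {a})" and L: "compact L" "L \<subseteq> - {a}" and "0 < e0" "0 < e"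
    and K: "continuous_on K h" "h ` K \<subseteq> - {a}" "continuous_on K u"
    and R: "\<And>w. w \<in> L \<Longrightarrow> norm (1 / (w - a)) \<le> R"
    and corr: "\<And>v e. continuous_on K v \<Longrightarrow> 0 < e \<Longrightarrow> correctable h a R K v e"
  shows "\<exists>g\<in>holo_nhd (- {a}) g0 L e0. \<forall>z\<in>K. norm (g (h z) - u z) < e"
proof -
  have hol: "g0 holomorphic_on - {a}" using g0 by (simp add: holo_space_def)
  have "continuous_on K (\<lambda>z. g0 (h z))"
    using K by (intro continuous_on_compose2[OF holomorphic_on_imp_continuous_on[OF hol]])
  then have "continuous_on K (\<lambda>z. u z - g0 (h z))"
    by (intro continuous_intros K)
  then have "correctable h a R K (\<lambda>z. u z - g0 (h z)) (min e0 e)"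
    using \<open>0 < e0\<close> \<open>0 < e\<close> by (intro corr) auto
  then obtain P where P: "P holomorphic_on UNIV" "\<forall>\<zeta>\<in>cball 0 R. norm (P \<zeta>) < min e0 e"
      "\<forall>z\<in>K. norm (P (1 / (h z - a)) - (u z - g0 (h z))) < min e0 e"
    unfolding correctable_def by blast
  define g where "g = restrict (\<lambda>w. g0 w + P (1 / (w - a))) (- {a})"
  have "(P \<circ> (\<lambda>w. 1 / (w - a))) holomorphic_on - {a}"
    by (intro holomorphic_on_compose_gen[OF _ P(1)] holomorphic_intros) auto
  then have "(\<lambda>w. g0 w + P (1 / (w - a))) holomorphic_on - {a}"
    using hol by (auto simp: o_def intro!: holomorphic_intros)
  then have "g holomorphic_on - {a}"
    by (rule holomorphic_transform) (simp add: g_def)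
  then have "g \<in> holo_space (- {a})"
    by (simp add: g_def holo_space_def)
  moreover have "dist (g w) (g0 w) < e0" if "w \<in> L" for w
  proof -
    have "w \<in> - {a}" using that L(2) by blast
    then have "g w = g0 w + P (1 / (w - a))" by (simp add: g_def)
    moreover have "1 / (w - a) \<in> cball 0 R" using R[OF that] by simp
    with P(2) have "norm (P (1 / (w - a))) < min e0 e" by blast
    ultimately show ?thesis by (simp add: dist_norm)
  qed
  moreover have "norm (g (h z) - u z) < e" if "z \<in> K" for z
  proof -
    have "h z \<in> - {a}" using that K(2) by blast
    then have "g (h z) = g0 (h z) + P (1 / (h z - a))" by (simp add: g_def)
    then have "g (h z) - u z = P (1 / (h z - a)) - (u z - g0 (h z))" by simp
    moreover have "norm (P (1 / (h z - a)) - (u z - g0 (h z))) < min e0 e" using P(3) that by blast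
    ultimately show ?thesis by (simp only: min_less_iff_conj)
  qed
  ultimately show ?thesis by (intro bexI[of _ g]) (simp_all add: holo_nhd_def)
qed

text \<open>The number \<open>R\<close> has to be chosen after the compact set \<open>L\<close> of a neighbourhood in the space of
holomorphic functions, and the index \<open>n\<close> after \<open>R\<close>; countably many targets \<open>d\<close> suffice because they
are dense in \<open>C(K)\<close>.\<close>

lemma comeager_in_approximating_compositions:
  fixes h :: "nat \<Rightarrow> complex \<Rightarrow> complex"
  assumes K: "compact K" "\<And>n. continuous_on K (h n)" "\<And>n. h n ` K \<subseteq> - {a}"
    and corr: "\<And>R::nat. \<exists>n\<ge>1. \<forall>v e. continuous_on K v \<longrightarrow> 0 < e \<longrightarrow> correctable (h n) a R K v e"
  shows "comeager_in (holo_topology (- {a})) {g \<in> holo_space (- {a}).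
    \<forall>u e. continuous_on K u \<longrightarrow> 0 < e \<longrightarrow> (\<exists>n\<ge>1. \<forall>z\<in>K. norm (g (h n z) - u z) < e)}"
proof -
  obtain D :: "(complex \<Rightarrow> complex) set" where D: "countable D" "D \<noteq> {}"
    "\<And>d. d \<in> D \<Longrightarrow> continuous_on UNIV d"
    "\<And>u. continuous_on K u \<Longrightarrow> approximable D K u"
    using countable_dense_continuous K(1) by metis
  have D_cont: "continuous_on K d" if "d \<in> D" for d
    using D(3)[OF that] by (rule continuous_on_subset) simp
  define \<O> where "\<O> = (\<lambda>(d, m). \<Union>n\<in>{1..}. {g \<in> holo_space (- {a}). \<forall>z\<in>K. norm (g (h n z) - d z) < 1 / Suc m})"
  show ?thesis
  proof (rule comeager_in_holo_INT)
    show "countable (D \<times> (UNIV :: nat set))" "D \<times> (UNIV :: nat set) \<noteq> {}"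
      using D(1,2) by auto
    fix i assume "i \<in> D \<times> (UNIV :: nat set)"
    then obtain d m where i: "i = (d, m)" "d \<in> D" by auto
    show "openin (holo_topology (- {a})) (\<O> i)"
      unfolding i \<O>_def prod.case
      by (intro openin_Union) (auto intro!: openin_approximating_composition K D_cont i)
    fix g L and e :: real assume g: "g \<in> holo_space (- {a})" "compact L" "L \<subseteq> - {a}" "0 < e"
    have "continuous_on L (\<lambda>w. 1 / (w - a))" using g(3) by (auto intro!: continuous_intros)
    then have "bounded ((\<lambda>w. 1 / (w - a)) ` L)"
      using g(2) by (intro compact_imp_bounded compact_continuous_image)
    then obtain b where b: "\<And>w. w \<in> L \<Longrightarrow> norm (1 / (w - a)) \<le> b" by (auto simp: bounded_iff)
    obtain R :: nat where "b \<le> R" using real_arch_simple by blast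
    with b have R: "norm (1 / (w - a)) \<le> real R" if "w \<in> L" for w using that by (meson order_trans)
    obtain n where n: "n \<ge> 1" "\<And>v e. continuous_on K v \<Longrightarrow> 0 < e \<Longrightarrow> correctable (h n) a R K v e"
      using corr by blast
    obtain k where "k \<in> holo_nhd (- {a}) g L e" "\<forall>z\<in>K. norm (k (h n z) - d z) < 1 / Suc m"
      using dense_approximating_composition[OF g _ K(2,3) D_cont[OF i(2)] R n(2), of "1 / Suc m"] by auto
    with n(1) show "\<O> i \<inter> holo_nhd (- {a}) g L e \<noteq> {}"
      by (auto simp: i(1) \<O>_def holo_nhd_def)
  next
    show "(\<Inter>i\<in>D \<times> UNIV. \<O> i) \<subseteq> {g \<in> holo_space (- {a}).
      \<forall>u e. continuous_on K u \<longrightarrow> 0 < e \<longrightarrow> (\<exists>n\<ge>1. \<forall>z\<in>K. norm (g (h n z) - u z) < e)}"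
    proof (intro subsetI CollectI conjI allI impI)
      fix g assume g: "g \<in> (\<Inter>i\<in>D \<times> UNIV. \<O> i)"
      with D(2) show "g \<in> holo_space (- {a})" by (fastforce simp: \<O>_def)
      fix u :: "complex \<Rightarrow> complex" and e :: real assume u: "continuous_on K u" and "0 < e"
      then obtain d where d: "d \<in> D" "\<forall>z\<in>K. norm (d z - u z) < e / 2"
        using D(4)[OF u] unfolding approximable_def by (meson half_gt_zero)
      obtain m where m: "1 / Suc m < e / 2" using \<open>0 < e\<close> by (meson nat_approx_posE half_gt_zero)
      have "g \<in> \<O> (d, m)" using g d(1) by blast
      then obtain n where n: "n \<ge> 1" "\<forall>z\<in>K. norm (g (h n z) - d z) < 1 / Suc m"
        by (auto simp: \<O>_def)
      have "norm (g (h n z) - u z) < e" if "z \<in> K" for z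
        using norm_triangle_ineq[of "g (h n z) - d z" "d z - u z"] n(2) d(2) m that by fastforce
      with n(1) show "\<exists>n\<ge>1. \<forall>z\<in>K. norm (g (h n z) - u z) < e" by blast
    qed
  qed auto
qed

lemma CK_universalI:
  assumes "compact K" "K \<subseteq> U - {a}" "g holomorphic_on - {a}"
    and f: "\<And>n. continuous_on K (f ^^ n)" "\<And>n. (f ^^ n) ` K \<subseteq> - {a}"
    and dense: "\<And>u e. continuous_on K u \<Longrightarrow> 0 < e \<Longrightarrow> \<exists>n\<ge>1. \<forall>z\<in>K. norm (g ((f ^^ n) z) - u z) < e"
  shows "CK_universal f U a K g"
proof -
  interpret C: Metric_space "cont_space K" "sup_dist K"
    by (rule Metric_space_sup_dist[OF assms(1)])
  have mem: "restrict (g \<circ> (f ^^ n)) K \<in> cont_space K" for n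
  proof -
    have "continuous_on K (\<lambda>z. g ((f ^^ n) z))"
      using f by (intro continuous_on_compose2[OF holomorphic_on_imp_continuous_on[OF assms(3)]])
    then show ?thesis by (simp add: cont_space_def cong: continuous_on_cong)
  qed
  have "\<exists>n\<ge>1. restrict (g \<circ> (f ^^ n)) K \<in> C.mball u r" if u: "u \<in> cont_space K" and "0 < r" for u r
  proof -
    have "continuous_on K u" using u by (simp add: cont_space_def)
    then obtain n where n: "n \<ge> 1" "\<forall>z\<in>K. norm (g ((f ^^ n) z) - u z) < r / 2"
      using dense[of u "r / 2"] \<open>0 < r\<close> by auto
    have "sup_dist K u (restrict (g \<circ> (f ^^ n)) K) \<le> r / 2"
      using n(2) \<open>0 < r\<close> by (intro sup_dist_leI) (auto simp: norm_minus_commute less_imp_le)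
    with n(1) u mem \<open>0 < r\<close> show ?thesis by auto
  qed
  then show ?thesis
    using assms(2) unfolding CK_universal_def topspace_cont_topology[OF assms(1)]
    unfolding cont_topology_def C.metric_closure_of by blast
qed

section \<open>Universal functions near a superattracting fixed point\<close>

theorem theorem3p7:
  fixes f \<phi> :: "complex \<Rightarrow> complex" and z0 :: complex and W U V :: "complex set" and p :: nat
    and \<delta> :: real
  assumes "open W" "z0 \<in> W" "f holomorphic_on W" "\<not> f constant_on W"
    and "f z0 = z0" "deriv f z0 = 0"
    and "p = (LEAST n. 1 \<le> n \<and> (deriv ^^ n) f z0 \<noteq> 0)"
    and "open U" "z0 \<in> U" "U \<subseteq> W" "f ` U \<subseteq> U"
    and "open V" "0 \<in> V" "V \<subseteq> ball 0 1"
    and "\<phi> holomorphic_on U" "bij_betw \<phi> U V"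
    and "\<And>z n. z \<in> U \<Longrightarrow> 1 \<le> n \<Longrightarrow> \<phi> ((f ^^ n) z) = \<phi> z ^ (p ^ n)"
    and "0 < \<delta>" "cball 0 \<delta> \<subseteq> V"
  shows "comeager_in (compacts_topology {z \<in> U. \<phi> z \<in> cball 0 \<delta>})
    {K \<in> nonempty_compacts {z \<in> U. \<phi> z \<in> cball 0 \<delta>}.
       comeager_in (holo_topology (- {z0})) {g \<in> holo_space (- {z0}). CK_universal f U z0 K g}}"
proof -
  let ?B = "{z \<in> U. \<phi> z \<in> cball 0 \<delta>}"
  note conj = assms(17)
  have inj: "inj_on \<phi> U" and im: "\<phi> ` U = V" using assms(16) by (auto simp: bij_betw_def)
  have conj1: "\<phi> (f z) = \<phi> z ^ p" if "z \<in> U" for z using conj[OF that, of 1] by simp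
  \<comment> \<open>If \<open>f\<close> were constant near \<open>z0\<close>, then \<open>p\<close> would be the least element of an empty set, of which nothing
    is known. So \<open>p > 1\<close> is derived from the functional equation: \<open>p = 0\<close> contradicts \<open>V \<subseteq> ball 0 1\<close>, and
    \<open>p = 1\<close> would make \<open>f\<close> the identity, against \<open>deriv f z0 = 0\<close>.\<close>
  have "p \<noteq> 0"
  proof
    assume "p = 0"
    then have "\<phi> z0 = 1" using conj1[OF assms(9)] assms(5) by simp
    moreover have "\<phi> z0 \<in> ball 0 1" using im assms(9,14) by blast
    ultimately show False by simp
  qed
  moreover have "p \<noteq> 1"
  proof
    assume "p = 1"
    have id: "f z = z" if "z \<in> U" for z
    proof (rule inj_onD[OF inj])
      show "\<phi> (f z) = \<phi> z" using conj1[OF that] \<open>p = 1\<close> by simp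
      show "f z \<in> U" using that assms(11) by blast
    qed (rule that)
    have "deriv f z0 = deriv (\<lambda>z. z) z0"
      by (intro deriv_cong_ev eventually_mono[OF eventually_nhds_in_open[OF assms(8,9)]] id refl)
    with assms(6) show False by simp
  qed
  ultimately have p: "p > 1" by simp
  have \<phi>0: "\<phi> z0 = 0"
  proof (rule ccontr)
    assume "\<phi> z0 \<noteq> 0"
    moreover have "\<phi> z0 = \<phi> z0 ^ p" using conj1[OF assms(9)] assms(5) by simp
    moreover have "norm (\<phi> z0) < 1" using im assms(9,14) by auto
    ultimately show False using p power_strict_decreasing[of 1 p "norm (\<phi> z0)"]
      by (metis less_irrefl norm_power power_one_right zero_less_norm_iff)
  qed
  obtain \<psi> where \<psi>: "\<psi> holomorphic_on V" "\<And>z. z \<in> U \<Longrightarrow> \<psi> (\<phi> z) = z"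
    using holomorphic_has_inverse[OF assms(15,8) inj] im by metis
  have \<psi>_cont: "continuous_on V \<psi>" using \<psi>(1) by (rule holomorphic_on_imp_continuous_on)
  have B_eq: "?B = \<psi> ` cball 0 \<delta>"
  proof (intro equalityI subsetI)
    fix z assume "z \<in> ?B"
    then show "z \<in> \<psi> ` cball 0 \<delta>" using \<psi>(2) by force
  next
    fix z assume "z \<in> \<psi> ` cball 0 \<delta>"
    then obtain y where "y \<in> cball 0 \<delta>" "y \<in> \<phi> ` U" "z = \<psi> y" using assms(19) im by blast
    then show "z \<in> ?B" using \<psi>(2) by auto
  qed
  have cont: "continuous_on (cball 0 \<delta>) \<psi>" using \<psi>_cont assms(19) by (rule continuous_on_subset)
  have "compact ?B" unfolding B_eq by (intro compact_continuous_image cont compact_cball)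
  have perfect: "x islimpt ?B" if "x \<in> ?B" for x
  proof (rule connected_imp_perfect[OF _ that])
    show "connected ?B" unfolding B_eq by (intro connected_continuous_image cont connected_cball)
    have "of_real \<delta> \<in> cball (0::complex) \<delta>" using assms(18) by simp
    then obtain z where z: "z \<in> U" "\<phi> z = of_real \<delta>" using assms(19) im by (metis imageE subsetD)
    then have "z \<in> ?B" "z0 \<in> ?B" "z \<noteq> z0" using \<phi>0 assms(9,18) by auto
    then show "?B \<noteq> {y}" for y by (metis singletonD)
  qed
  have iter_U: "(f ^^ n) ` U \<subseteq> U" for n
    using assms(11) by (induction n) auto
  have iter_cont: "continuous_on U (f ^^ n)" for n
  proof (induction n)
    case (Suc n)
    have "continuous_on U f"
      using continuous_on_subset[OF holomorphic_on_imp_continuous_on[OF assms(3)] assms(10)] .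
    then have "continuous_on U (\<lambda>z. f ((f ^^ n) z))"
      using Suc iter_U by (rule continuous_on_compose2)
    then show ?case by (simp add: o_def)
  qed (simp add: id_def)
  have conj': "\<phi> ((f ^^ n) z) = \<phi> z ^ (p ^ n)" if "z \<in> U" for n z
    using conj[OF that, of n] by (cases "n = 0") auto
  \<comment> \<open>In the coordinate \<open>\<phi>\<close> the fibres of the iterates are sets of roots.\<close>
  have fibres: "finite {x \<in> ?B. (f ^^ n) x = y}" for n y
  proof (rule finite_subset)
    show "{x \<in> ?B. (f ^^ n) x = y} \<subseteq> \<psi> ` {c. c ^ (p ^ n) = \<phi> y}"
      using conj' \<psi>(2) by force
    show "finite (\<psi> ` {c. c ^ (p ^ n) = \<phi> y})"
      using p by (intro finite_imageI finite_nth_roots) simp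
  qed
  have conv: "\<exists>n\<ge>1. \<forall>z\<in>?B. dist ((f ^^ n) z) z0 * real R < 1" for R
  proof -
    have "\<psi> 0 = z0" using \<psi>(2)[OF assms(9)] \<phi>0 by simp
    have "0 < 1 / real (R + 1)" by simp
    then obtain \<eta> where \<eta>': "\<eta> > 0" "\<forall>w\<in>V. dist w 0 < \<eta> \<longrightarrow> dist (\<psi> w) (\<psi> 0) < 1 / (R + 1)"
      using \<psi>_cont assms(13) unfolding continuous_on_iff by blast
    then have \<eta>: "\<eta> > 0" "\<And>w. w \<in> V \<Longrightarrow> norm w < \<eta> \<Longrightarrow> dist (\<psi> w) z0 < 1 / (R + 1)"
      using \<open>\<psi> 0 = z0\<close> by (simp_all add: dist_norm)
    have "of_real \<delta> \<in> cball (0::complex) \<delta>" using assms(18) by simp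
    then have "of_real \<delta> \<in> ball (0::complex) 1" using assms(14,19) by blast
    then have "\<delta> < 1" using assms(18) by simp
    then have "(\<lambda>n. \<delta> ^ n) \<longlonglongrightarrow> 0" using assms(18) by (intro LIMSEQ_realpow_zero) auto
    then have "\<forall>\<^sub>F n in sequentially. \<delta> ^ n < \<eta>" using \<eta>(1) by (rule order_tendstoD)
    then obtain n where n: "n \<ge> 1" "\<delta> ^ n < \<eta>"
      unfolding eventually_sequentially using max.cobounded1 max.cobounded2 by blast
    have "dist ((f ^^ n) z) z0 * real R < 1" if "z \<in> ?B" for z
    proof -
      have z: "z \<in> U" "norm (\<phi> z) \<le> \<delta>" using that by auto
      then have fz: "(f ^^ n) z \<in> U" using iter_U by blast
      have "norm (\<phi> ((f ^^ n) z)) = norm (\<phi> z) ^ (p ^ n)" by (simp add: conj'[OF z(1)] norm_power)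
      also have "\<dots> \<le> \<delta> ^ (p ^ n)" by (intro power_mono z) auto
      also have "\<dots> \<le> \<delta> ^ n"
        using power_gt_expt[of p n] p \<open>\<delta> < 1\<close> assms(18) by (intro power_decreasing) auto
      finally have "norm (\<phi> ((f ^^ n) z)) < \<eta>" using n(2) by simp
      moreover have "\<phi> ((f ^^ n) z) \<in> V" using im fz by blast
      ultimately have "dist (\<psi> (\<phi> ((f ^^ n) z))) z0 < 1 / (R + 1)" by (intro \<eta>(2))
      then have "dist ((f ^^ n) z) z0 * (R + 1) < 1" using \<psi>(2)[OF fz] by (simp add: field_simps)
      moreover have "dist ((f ^^ n) z) z0 * R \<le> dist ((f ^^ n) z) z0 * (R + 1)"
        by (intro mult_left_mono) auto
      ultimately show ?thesis by simp
    qed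
    with n(1) show ?thesis by blast
  qed
  let ?\<K> = "{K \<in> nonempty_compacts ?B. \<forall>n R u e. (\<forall>z\<in>?B. dist ((f ^^ n) z) z0 * real R < 1) \<longrightarrow>
      continuous_on K u \<longrightarrow> 0 < e \<longrightarrow> correctable (f ^^ n) z0 R K u e}"
  have generic: "comeager_in (compacts_topology ?B) ?\<K>"
    using \<open>compact ?B\<close> perfect assms(8) _ iter_cont fibres by (rule comeager_in_correctable) auto
  have "comeager_in (holo_topology (- {z0})) {g \<in> holo_space (- {z0}). CK_universal f U z0 K g}"
    if K: "K \<in> ?\<K>" for K
  proof -
    have "K \<in> nonempty_compacts ?B" using CollectD[OF K] by (rule conjunct1)
    then have "compact K" "K \<subseteq> U" by (auto simp: nonempty_compacts_def)
    have K_corr: "\<forall>n R u e. (\<forall>z\<in>?B. dist ((f ^^ n) z) z0 * real R < 1) \<longrightarrow>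
        continuous_on K u \<longrightarrow> 0 < e \<longrightarrow> correctable (f ^^ n) z0 R K u e"
      using CollectD[OF K] by (rule conjunct2)
    \<comment> \<open>The radius \<open>0\<close> gives that no iterate maps a point of \<open>K\<close> to \<open>z0\<close>; the iterate with \<open>n = 0\<close> yields \<open>z0 \<notin> K\<close>.\<close>
    have "correctable (f ^^ n) z0 (real 0) K (\<lambda>_. 0) 1" for n
      by (rule K_corr[rule_format]) simp_all
    then have avoid: "(f ^^ n) ` K \<subseteq> - {z0}" for n unfolding correctable_def by blast
    have K_sub: "K \<subseteq> U - {z0}" using avoid[of 0] \<open>K \<subseteq> U\<close> by auto
    have K_cont: "continuous_on K (f ^^ n)" for n using iter_cont \<open>K \<subseteq> U\<close> by (rule continuous_on_subset)
    have "\<exists>n\<ge>1. \<forall>v e. continuous_on K v \<longrightarrow> 0 < e \<longrightarrow> correctable (f ^^ n) z0 (real R) K v e" for R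
      using conv[of R] K_corr by meson
    then have "comeager_in (holo_topology (- {z0})) {g \<in> holo_space (- {z0}).
        \<forall>u e. continuous_on K u \<longrightarrow> 0 < e \<longrightarrow> (\<exists>n\<ge>1. \<forall>z\<in>K. norm (g ((f ^^ n) z) - u z) < e)}"
      by (intro comeager_in_approximating_compositions \<open>compact K\<close> K_cont avoid)
    then show ?thesis
    proof (rule comeager_in_mono)
      show "{g \<in> holo_space (- {z0}). \<forall>u e. continuous_on K u \<longrightarrow> 0 < e \<longrightarrow>
          (\<exists>n\<ge>1. \<forall>z\<in>K. norm (g ((f ^^ n) z) - u z) < e)} \<subseteq> {g \<in> holo_space (- {z0}). CK_universal f U z0 K g}"
      proof (intro subsetI CollectI conjI)
        fix g assume g: "g \<in> {g \<in> holo_space (- {z0}). \<forall>u e. continuous_on K u \<longrightarrow> 0 < e \<longrightarrow>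
          (\<exists>n\<ge>1. \<forall>z\<in>K. norm (g ((f ^^ n) z) - u z) < e)}"
        then show "g \<in> holo_space (- {z0})" by simp
        then have "g holomorphic_on - {z0}" by (simp add: holo_space_def)
        then show "CK_universal f U z0 K g"
          by (rule CK_universalI[OF \<open>compact K\<close> K_sub _ K_cont avoid]) (use g in simp)
      qed
    qed auto
  qed
  then show ?thesis
    by (intro comeager_in_mono[OF generic]) auto
qed

end
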